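(* Let $T=(V,E)$ be a finite tree with at least two vertices whose edges carry real $s\times s$ lower triangular matrix weights with positive diagonal entries. Let $L(T)$ be the Laplacian matrix of $T$ and let $\mu(T)$ be the first (smallest) non-zero eigenvalue of $L(T)$. Then $\kappa(T)\le\mu(T)$.
   Context: Laplacian: for a tree $T=(V,E)$ on $n$ vertices with $s\times s$ matrix edge weights $W(e)$, $L(T)=[l_{uv}]_{u,v\in V}$ is the $ns\times ns$ block matrix whose $s\times s$ blocks are: for $u\ne v$, $l_{uv}=-W(e)$ if $u,v$ are joined by the edge $e$, and $l_{uv}=\mathbf 0$ if $u,v$ are not adjacent; $l_{vv}$ is the sum of the weights of the edges incident with $v$. The eigenvalues of $L(T)$ are real and nonnegative and $L(T)$ has rank $(n-1)s$; with eigenvalues in increasing order $\lambda_1\le\dots\le\lambda_{ns}$, $\mu(T)=\lambda_{s+1}(L(T))$. For $v\in V$, $L_v$ is $L(T)$ with the row block and column block of $v$ deleted; it is invertible, and $M_v=L_v^{-1}$. A branch at $v$ is a connected component of the graph obtained from $T$ by deleting $v$ and its incident edges; $B_v(u)$ is the branch at $v$ containing $u$ ($u\neq v$). $M_v$ is block diagonal with one diagonal block $M_v(B)$ (bottleneck matrix) for each branch $B$ at $v$; for $x,y\in B$ the $(x,y)$ block of $M_v(B)$ is $\sum_{e\in \mathcal P(x,v)\cap\mathcal P(y,v)}W(e)^{-1}$, where $\mathcal P(a,b)$ is the path joining $a$ and $b$. Write $M_v(u)=M_v(B_v(u))$ and $\rho(\cdot)$ for spectral radius. A branch $B$ at $v$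 is a Perron branch at $v$ if $\rho(M_v(B))=\rho(M_v)$, equivalently if $\rho(M_v(B))$ is the largest among all branches at $v$. One of two cases occurs: either there is a unique vertex $v$ with two or more Perron branches at $v$ (the characteristic-like vertex), or there is a unique pair of adjacent vertices $u\sim v$ such that $B_u(v)$ is the unique Perron branch at $u$ and $B_v(u)$ is the unique Perron branch at $v$ (the edge $e$ between $u$ and $v$ is the characteristic-like edge). The constant $\kappa(T)$: (a) if $T$ has a characteristic-like vertex $v$, then $\kappa(T)=1/\rho(M_v)$; (b) if $T$ has a characteristic-like edge $e$ between $u$ and $v$, then $$\kappa(T)=\frac{1}{\rho\big(M_u(v)-\nu(J\otimes W(e)^{-1})\big)}=\frac{1}{\rho\big(M_v(u)-(1-\nu)(J\otimes W(e)^{-1})\big)},$$ where $0<\nu<1$ is such that the two spectral radii are equal (such a $\nu$ exists). Here $J$ is the all-ones matrix of conformal order and $A\otimes B=[a_{ij}B]$ is the Kronecker product. *)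

theory Defs
  imports
    "Jordan_Normal_Form.Spectral_Radius"
    "Jordan_Normal_Form.DL_Submatrix"
    "Jordan_Normal_Form.Gauss_Jordan_Elimination"
    "Graph_Theory.Graph_Theory"
begin

text \<open>
  A finite simple graph is a \<^locale>\<open>pair_graph\<close>: every undirected edge is represented by the two arcs
  between its endpoints. Hence every edge yields a directed cycle of length 2, and undirected
  cycles correspond to directed cycles of length at least 3. (The predicate \<open>tree\<close> of
  Digraph-Component only forbids directed cycles, so it is not usable for symmetric digraphs.)
\<close>

definition is_tree :: "'a pair_pre_digraph \<Rightarrow> bool" where
  "is_tree T \<longleftrightarrow> pair_graph T \<and> Digraph_Component.connected (with_proj T) \<and>
     \<not> (\<exists>p. pre_digraph.cycle (with_proj T) p \<and> 3 \<le> length p)"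

definition kronecker :: "'a::times mat \<Rightarrow> 'a mat \<Rightarrow> 'a mat" where
  "kronecker A B = mat (dim_row A * dim_row B) (dim_col A * dim_col B)
     (\<lambda>(i,j). A $$ (i div dim_row B, j div dim_col B) * B $$ (i mod dim_row B, j mod dim_col B))"

definition all_ones :: "nat \<Rightarrow> 'a::one mat" where
  "all_ones m = mat m m (\<lambda>_. 1)"

definition inverse_mat :: "'a::field mat \<Rightarrow> 'a mat" where
  "inverse_mat A = the (mat_inverse A)"

definition real_spectral_radius :: "real mat \<Rightarrow> real" where
  "real_spectral_radius A = spectral_radius (map_mat complex_of_real A)"

text \<open>
  Block matrices indexed by a finite set \<open>X\<close> of vertices list the elements of \<open>X\<close> in increasing
  order; the order on the vertices serves no other purpose. The set \<open>block_indices s X U\<close> collects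
  the scalar indices that lie in the blocks of the vertices in \<open>U\<close>.
\<close>

definition block_mat :: "nat \<Rightarrow> 'a::linorder set \<Rightarrow> ('a \<Rightarrow> 'a \<Rightarrow> 'b mat) \<Rightarrow> 'b mat" where
  "block_mat s X f = mat (card X * s) (card X * s)
     (\<lambda>(i,j). f (sorted_list_of_set X ! (i div s)) (sorted_list_of_set X ! (j div s))
        $$ (i mod s, j mod s))"

definition block_indices :: "nat \<Rightarrow> 'a::linorder set \<Rightarrow> 'a set \<Rightarrow> nat set" where
  "block_indices s X U = {k. k < card X * s \<and> sorted_list_of_set X ! (k div s) \<in> U}"

definition principal_block_submat ::
  "nat \<Rightarrow> 'a::linorder set \<Rightarrow> 'b mat \<Rightarrow> 'a set \<Rightarrow> 'b mat" where
  "principal_block_submat s X A U = submatrix A (block_indices s X U) (block_indices s X U)"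

text \<open>The weight of the edge joining \<open>u\<close> and \<open>v\<close> is \<open>W {u, v}\<close>.\<close>

definition laplacian_block ::
  "nat \<Rightarrow> 'a pair_pre_digraph \<Rightarrow> ('a set \<Rightarrow> real mat) \<Rightarrow> 'a \<Rightarrow> 'a \<Rightarrow> real mat" where
  "laplacian_block s T W u v =
     (if u = v then mat s s (\<lambda>ij. \<Sum>w \<in> {w. (v, w) \<in> parcs T}. W {v, w} $$ ij)
      else if (u, v) \<in> parcs T then - W {u, v}
      else 0\<^sub>m s s)"

definition laplacian ::
  "nat \<Rightarrow> 'a::linorder pair_pre_digraph \<Rightarrow> ('a set \<Rightarrow> real mat) \<Rightarrow> real mat" where
  "laplacian s T W = block_mat s (pverts T) (laplacian_block s T W)"

text \<open>The set is a set of reals; the eigenvalues of the Laplacians considered here are all real.\<close>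

definition mu :: "nat \<Rightarrow> 'a::linorder pair_pre_digraph \<Rightarrow> ('a set \<Rightarrow> real mat) \<Rightarrow> real" where
  "mu s T W = Min {l \<in> spectrum (laplacian s T W). l \<noteq> 0}"

text \<open>The matrix \<open>M\<^sub>v\<close>, with rows and columns indexed by \<open>pverts T - {v}\<close>.\<close>

definition M_mat ::
  "nat \<Rightarrow> 'a::linorder pair_pre_digraph \<Rightarrow> ('a set \<Rightarrow> real mat) \<Rightarrow> 'a \<Rightarrow> real mat" where
  "M_mat s T W v =
     inverse_mat (principal_block_submat s (pverts T) (laplacian s T W) (pverts T - {v}))"

text \<open>
  After deletion of a vertex the digraph is still symmetric, so its strongly connected components
  are the connected components of the undirected graph.
\<close>

definition branches :: "'a pair_pre_digraph \<Rightarrow> 'a \<Rightarrow> 'a set set" where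
  "branches T v = pre_digraph.sccs_verts (pre_digraph.del_vert (with_proj T) v)"

definition branch_of :: "'a pair_pre_digraph \<Rightarrow> 'a \<Rightarrow> 'a \<Rightarrow> 'a set" where
  "branch_of T v u = pre_digraph.scc_of (pre_digraph.del_vert (with_proj T) v) u"

definition bottleneck ::
  "nat \<Rightarrow> 'a::linorder pair_pre_digraph \<Rightarrow> ('a set \<Rightarrow> real mat) \<Rightarrow> 'a \<Rightarrow> 'a set \<Rightarrow> real mat" where
  "bottleneck s T W v B = principal_block_submat s (pverts T - {v}) (M_mat s T W v) B"

definition perron_branches ::
  "nat \<Rightarrow> 'a::linorder pair_pre_digraph \<Rightarrow> ('a set \<Rightarrow> real mat) \<Rightarrow> 'a \<Rightarrow> 'a set set" where
  "perron_branches s T W v =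
     {B \<in> branches T v.
        real_spectral_radius (bottleneck s T W v B) = real_spectral_radius (M_mat s T W v)}"

definition characteristic_like_vertex ::
  "nat \<Rightarrow> 'a::linorder pair_pre_digraph \<Rightarrow> ('a set \<Rightarrow> real mat) \<Rightarrow> 'a \<Rightarrow> bool" where
  "characteristic_like_vertex s T W v \<longleftrightarrow>
     v \<in> pverts T \<and> 2 \<le> card (perron_branches s T W v)"

definition characteristic_like_edge ::
  "nat \<Rightarrow> 'a::linorder pair_pre_digraph \<Rightarrow> ('a set \<Rightarrow> real mat) \<Rightarrow> 'a \<Rightarrow> 'a \<Rightarrow> bool" where
  "characteristic_like_edge s T W u v \<longleftrightarrow>
     (u, v) \<in> parcs T \<and>
     perron_branches s T W u = {branch_of T u v} \<and>
     perron_branches s T W v = {branch_of T v u}"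

text \<open>
  The spectral radius of \<open>M\<^sub>u(v) - t (J \<otimes> W(e)\<^sup>-\<^sup>1)\<close>, where \<open>e\<close> is the edge joining \<open>u\<close> and \<open>v\<close>.
\<close>

definition edge_radius ::
  "nat \<Rightarrow> 'a::linorder pair_pre_digraph \<Rightarrow> ('a set \<Rightarrow> real mat) \<Rightarrow> 'a \<Rightarrow> 'a \<Rightarrow> real \<Rightarrow> real" where
  "edge_radius s T W u v t =
     real_spectral_radius (bottleneck s T W u (branch_of T u v)
       - t \<cdot>\<^sub>m kronecker (all_ones (card (branch_of T u v))) (inverse_mat (W {u, v})))"

text \<open>
  The choice below is unambiguous: a tree with lower triangular weights with positive diagonals has
  either a unique characteristic-like vertex or a unique characteristic-like edge, and in the latter
  case the value does not depend on the choice of \<open>\<nu>\<close> or on the orientation of the edge.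
\<close>

definition kappa :: "nat \<Rightarrow> 'a::linorder pair_pre_digraph \<Rightarrow> ('a set \<Rightarrow> real mat) \<Rightarrow> real" where
  "kappa s T W = (SOME k.
     (\<exists>v. characteristic_like_vertex s T W v \<and> k = 1 / real_spectral_radius (M_mat s T W v)) \<or>
     (\<exists>u v \<nu>. characteristic_like_edge s T W u v \<and> 0 < \<nu> \<and> \<nu> < 1 \<and>
        edge_radius s T W u v \<nu> = edge_radius s T W v u (1 - \<nu>) \<and>
        k = 1 / edge_radius s T W u v \<nu>))"

end

theory Submission
  imports Defs "HOL-Analysis.Convex" "HOL-Analysis.Lipschitz"
begin

text \<open>
  Lower triangular weights decouple. If the scalar indices are grouped by their position inside the
  blocks, every matrix that occurs here becomes block triangular with \<open>s\<close> symmetric diagonal blocks,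
  and the \<open>i\<close>-th of them is the corresponding matrix of the tree with the scalar edge weights
  \<open>W e $$ (i, i)\<close>. Hence an eigenvalue of such a matrix is an eigenvalue of one of the symmetric
  blocks, and a spectral radius is at most \<open>r\<close> if and only if the quadratic forms of all these blocks
  are bounded by \<open>r\<close> times the squared norm (\<open>spectral_radius_le\<close> and \<open>spectral_radius_bounds_quad\<close>).

  For scalar weights, read the weights as conductances. An edge that is directed away from \<open>v\<close> cuts
  off a set \<open>D\<close> of vertices, and the bottleneck matrix at \<open>v\<close> is the sum of the rank one matrices
  \<open>1\<^sub>D 1\<^sub>D\<^sup>T / w\<close> over all edges. So it has the form \<open>R\<^sup>T R\<close>, where \<open>R\<^sup>T\<close> recovers a potential \<open>z - z v\<close>
  from its (scaled) differences along the edges. As \<open>R\<^sup>T R\<close> and \<open>R R\<^sup>T\<close> have the same norm, a bound \<open>r\<close>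
  for the quadratic form of the bottleneck matrix bounds the squared norm of \<open>z - z v\<close> by \<open>r\<close> times the
  energy of \<open>z\<close> (\<open>potential_bound\<close>). Apply this to an eigenvector \<open>z\<close> of a diagonal block of the
  Laplacian for the eigenvalue \<open>\<mu>\<close>. Its energy is \<open>\<mu>\<close> times its squared norm, and it is orthogonal to the
  constants, so that subtracting a constant does not decrease its norm. This gives \<open>1 \<le> r \<mu>\<close>.

  At a characteristic-like vertex \<open>v\<close> take \<open>r = \<rho>(M\<^sub>v)\<close> (\<open>vertex_bound\<close>). At a characteristic-like edge
  \<open>{u, v}\<close>, the two perturbed bottleneck matrices are those of the two parts into which the tree falls
  when the edge is cut at the point that divides its resistance in the ratio \<open>1 - \<nu>\<close> to \<open>\<nu>\<close>, seen
  from \<open>v\<close>. Subtracting from \<open>z\<close> its interpolated value at this point and adding the estimates for the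
  two parts gives the same conclusion with the common spectral radius (\<open>edge_bound\<close>).

  As \<open>\<kappa>\<close> is a choice, the defining property also has to be satisfiable. If no vertex has two Perron
  branches, every vertex points to its neighbour in its only Perron branch. In a finite tree two
  adjacent vertices then point at each other (\<open>neighbour_choice_reversed_somewhere\<close>). For their edge, the
  difference of the two radii is a continuous function of \<open>\<nu>\<close>. It is positive at \<open>0\<close>, where one radius is
  \<open>\<rho>(M\<^sub>u)\<close> and the other one belongs to the remaining branches at \<open>u\<close>, and negative at \<open>1\<close> by symmetry, so
  it vanishes somewhere in between (\<open>balanced_point_exists\<close>).
\<close>

section \<open>Branches of a tree\<close>

lemma pawalk_verts_snoc: "pcas c q d \<Longrightarrow> pawalk_verts c (q @ [(d, p)]) = pawalk_verts c q @ [p]"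
  by (induction q arbitrary: c) auto

locale finite_tree =
  fixes T :: "'a pair_pre_digraph"
  assumes is_tree: "is_tree T"
begin

abbreviation V where "V \<equiv> pverts T"
abbreviation E where "E \<equiv> parcs T"

lemma pair_graph: "pair_graph T"
  using is_tree unfolding is_tree_def by simp

lemma arc_vertices: "(a, b) \<in> E \<Longrightarrow> a \<in> V" "(a, b) \<in> E \<Longrightarrow> b \<in> V"
  using pair_graph pair_wf_digraph.in_arcsD1 pair_wf_digraph.in_arcsD2
  by (auto simp: pair_graph_def pair_digraph_def pair_fin_digraph_def)

lemma arc_sym: "(a, b) \<in> E \<Longrightarrow> (b, a) \<in> E"
proof -
  interpret pair_graph T by (rule pair_graph)
  show "(a, b) \<in> E \<Longrightarrow> (b, a) \<in> E" by (rule arcs_symmetric)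
qed

lemma arc_irrefl: "(a, a) \<notin> E"
proof -
  interpret pair_graph T by (rule pair_graph)
  show ?thesis using no_loops' by blast
qed

lemma finite_verts [simp]: "finite V" and finite_arcs [simp]: "finite E"
proof -
  interpret pair_graph T by (rule pair_graph)
  show "finite V" "finite E" by (rule pair_finite_verts pair_finite_arcs)+
qed

text \<open>
  Connectedness in the form in which it is used below: as an induction principle along arcs.
\<close>

lemma arc_closed_set_is_everything:
  assumes "x \<in> V" "x \<in> P" "\<And>a b. (a, b) \<in> E \<Longrightarrow> a \<in> P \<Longrightarrow> b \<in> P"
  shows "V \<subseteq> P"
proof
  fix y assume "y \<in> V"
  interpret pair_graph T by (rule pair_graph)
  let ?H = "mk_symmetric (with_proj T)"
  have H: "parcs ?H = E" "pverts ?H = V"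
    using arc_sym by (auto simp: mk_symmetric_def)
  have "x \<rightarrow>\<^sup>*\<^bsub>with_proj ?H\<^esub> y"
    using is_tree \<open>x \<in> V\<close> \<open>y \<in> V\<close>
    unfolding is_tree_def connected_def strongly_connected_def by (simp add: H)
  then have "(x, y) \<in> E\<^sup>*" using reachable_rtranclI[of "with_proj ?H" x y] by (simp add: H)
  then show "y \<in> P" by (induction rule: rtrancl_induct) (use assms in auto)
qed

abbreviation S :: "'a \<Rightarrow> 'a \<Rightarrow> 'a set" where "S \<equiv> branch_of T"

lemma arcs_ends_del_vert:
  "arcs_ends (pre_digraph.del_vert (with_proj T) p) = {(a, b) \<in> E. a \<noteq> p \<and> b \<noteq> p}"
  by (auto simp: arcs_ends_def arc_to_ends_def pre_digraph.del_vert_simps)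

lemma symmetric_del_vert: "symmetric (pre_digraph.del_vert (with_proj T) p)"
  unfolding symmetric_def sym_def arcs_ends_del_vert using arc_sym by auto

lemma branch_of_reachable:
  "S p c = {z. c \<rightarrow>\<^sup>*\<^bsub>pre_digraph.del_vert (with_proj T) p\<^esub> z}"
  unfolding branch_of_def pre_digraph.scc_of_def
  using symmetric_reachable[OF symmetric_del_vert] by fast

lemma wf_digraph_del: "wf_digraph (pre_digraph.del_vert (with_proj T) p)"
proof -
  interpret pair_graph T by (rule pair_graph)
  show ?thesis by (rule wf_digraph_del_vert)
qed

lemma branch_subset: "S p c \<subseteq> V - {p}"
  using wf_digraph.reachable_in_verts(2)[OF wf_digraph_del]
  by (fastforce simp: branch_of_reachable pre_digraph.del_vert_simps)

lemma apex_notin_branch [simp]: "p \<notin> S p c"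
  using branch_subset by blast

lemma branch_in_verts: "x \<in> S p c \<Longrightarrow> x \<in> V"
  using branch_subset by blast

lemma finite_branch [simp]: "finite (S p c)"
  using finite_subset[OF branch_subset] by simp

lemma root_in_branch:
  assumes "c \<in> V" "c \<noteq> p"
  shows "c \<in> S p c"
  using assms wf_digraph.reachable_refl[OF wf_digraph_del]
  by (auto simp: branch_of_reachable pre_digraph.del_vert_simps reachable_def)

lemma arc_root_in_branch: "(p, c) \<in> E \<Longrightarrow> c \<in> S p c"
  using root_in_branch arc_vertices arc_irrefl by metis

lemma branch_step:
  assumes "a \<in> S p c" "(a, b) \<in> E" "b \<noteq> p"
  shows "b \<in> S p c"
proof -
  have "a \<noteq> p" using assms(1) by auto
  then show ?thesis using assms wf_digraph.reachable_adj_trans[OF wf_digraph_del, of p c a b]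
    by (auto simp: branch_of_reachable arcs_ends_del_vert)
qed

text \<open>
  Together with \<open>branch_step\<close>, this describes a branch as the closure of its root under arcs that avoid
  the deleted vertex. It serves as the induction principle for branches.
\<close>

lemma branch_least:
  assumes "c \<in> P" "\<And>a b. a \<in> S p c \<Longrightarrow> a \<in> P \<Longrightarrow> (a, b) \<in> E \<Longrightarrow> b \<noteq> p \<Longrightarrow> b \<in> P"
  shows "S p c \<subseteq> P"
proof
  fix z assume "z \<in> S p c"
  interpret D: wf_digraph "pre_digraph.del_vert (with_proj T) p" by (rule wf_digraph_del)
  have "c \<rightarrow>\<^sup>*\<^bsub>pre_digraph.del_vert (with_proj T) p\<^esub> z"
    using \<open>z \<in> S p c\<close> by (simp add: branch_of_reachable)
  then have "z \<in> P \<and> z \<in> S p c"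
  proof (induction rule: D.reachable_induct)
    case base
    then show ?case using assms(1) root_in_branch by (auto simp: pre_digraph.del_vert_simps)
  next
    case (step x y)
    then have "(x, y) \<in> E" "y \<noteq> p" by (auto simp: arcs_ends_del_vert)
    then show ?case using assms(2)[of x y] branch_step[of x p c y] step by auto
  qed
  then show "z \<in> P" ..
qed

text \<open>
  Two neighbours of \<open>p\<close> in one branch at \<open>p\<close> would be joined by a path that avoids \<open>p\<close>, which the two
  arcs at \<open>p\<close> close to a cycle of length at least 3. All later facts about trees rest on this use of
  acyclicity.
\<close>

lemma branch_attached_once:
  assumes "(p, c) \<in> E" "(p, d) \<in> E" "d \<in> S p c"
  shows "d = c"
proof (rule ccontr)
  assume ne: "d \<noteq> c"
  interpret pair_graph T by (rule pair_graph)
  let ?D = "pre_digraph.del_vert (with_proj T) p"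
  interpret D: wf_digraph ?D by (rule wf_digraph_del)
  have "c \<rightarrow>\<^sup>*\<^bsub>?D\<^esub> d" using assms(3) by (simp add: branch_of_reachable)
  then obtain q where q: "D.apath c q d" using D.reachable_apath by blast
  have D_set: "set q \<subseteq> arcs ?D" "set (D.awalk_verts c q) \<subseteq> verts ?D"
    using q unfolding D.apath_def by (blast elim: D.awalkE)+
  have "D.awalk_verts c q = pawalk_verts c q"
    using compatible_awalk_verts[of ?D "with_proj T"]
    by (auto simp: compatible_def pre_digraph.del_vert_simps)
  moreover have "apath c q d" using q subgraph_apath_imp_apath[OF _ subgraph_del_vert] by blast
  ultimately have q': "awalk c q d" "distinct (pawalk_verts c q)" "p \<notin> set (pawalk_verts c q)"
    using D_set by (auto simp: apath_def pre_digraph.del_vert_simps)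
  have "q \<noteq> []" using q'(1) ne by (auto simp: awalk_Nil_iff)
  \<comment> \<open>the path from \<open>c\<close> to \<open>d\<close> that avoids \<open>p\<close>, closed through \<open>p\<close>\<close>
  let ?cyc = "(p, c) # q @ [(d, p)]"
  have "awalk p ?cyc p"
    using q'(1) assms(1,2) arc_sym[OF assms(2)] arc_vertices
    by (auto simp: awalk_simps)
  moreover have "awalk_verts p ?cyc = p # pawalk_verts c q @ [p]"
    using q'(1) pawalk_verts_snoc[of c q d p] by (simp add: awalk_def)
  ultimately have "cycle ?cyc" using q' unfolding cycle_def by auto
  moreover have "3 \<le> length ?cyc" using \<open>q \<noteq> []\<close> by (cases q) auto
  ultimately show False using is_tree unfolding is_tree_def by blast
qed

lemma arc_leaving_branch:
  assumes "(p, c) \<in> E" "a \<in> S p c" "(a, b) \<in> E" "b \<notin> S p c"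
  shows "a = c" "b = p"
proof -
  show "b = p" using branch_step assms by blast
  then show "a = c" using branch_attached_once[of p c a] assms arc_sym by blast
qed

lemma branch_complement:
  assumes "(p, c) \<in> E"
  shows "S c p = V - S p c"
proof -
  have cp: "(c, p) \<in> E" using assms arc_sym by blast
  have "S c p \<subseteq> - S p c"
  proof (rule branch_least)
    fix a b assume "a \<in> S c p" "a \<in> - S p c" "(a, b) \<in> E" "b \<noteq> c"
    then show "b \<in> - S p c" using arc_leaving_branch[OF assms, of b a] arc_sym by blast
  qed simp
  moreover have "V \<subseteq> S p c \<union> S c p"
  proof (rule arc_closed_set_is_everything)
    show "c \<in> V" "c \<in> S p c \<union> S c p" using arc_vertices arc_root_in_branch assms by auto
    fix a b assume "(a, b) \<in> E" "a \<in> S p c \<union> S c p"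
    then show "b \<in> S p c \<union> S c p"
      using arc_leaving_branch[OF assms] arc_leaving_branch[OF cp]
        arc_root_in_branch[OF assms] arc_root_in_branch[OF cp] by blast
  qed
  ultimately show ?thesis using branch_in_verts by blast
qed

lemma branch_containing:
  assumes "v \<in> V" "x \<in> V" "x \<noteq> v"
  obtains c where "(v, c) \<in> E" "x \<in> S v c"
proof -
  have "V \<subseteq> {v} \<union> (\<Union>c \<in> {c. (v, c) \<in> E}. S v c)"
  proof (rule arc_closed_set_is_everything)
    fix a b assume "(a, b) \<in> E" "a \<in> {v} \<union> (\<Union>c \<in> {c. (v, c) \<in> E}. S v c)"
    then show "b \<in> {v} \<union> (\<Union>c \<in> {c. (v, c) \<in> E}. S v c)"
      using arc_root_in_branch branch_step[of a v _ b] by blast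
  qed (use assms in auto)
  then show ?thesis using assms that by blast
qed

lemma branch_eq:
  assumes "x \<in> S p c"
  shows "S p x = S p c"
proof -
  interpret D: wf_digraph "pre_digraph.del_vert (with_proj T) p" by (rule wf_digraph_del)
  show ?thesis using assms symmetric_reachable[OF symmetric_del_vert] D.reachable_trans
    unfolding branch_of_reachable by (metis (no_types, lifting) Collect_cong mem_Collect_eq)
qed

lemma branches_disjoint:
  assumes "(v, c) \<in> E" "(v, d) \<in> E" "x \<in> S v c" "x \<in> S v d"
  shows "c = d"
  using branch_attached_once[OF assms(2,1)] branch_eq[OF assms(3)] branch_eq[OF assms(4)]
    arc_root_in_branch[OF assms(1)] by blast

lemma branches_eq:
  assumes "v \<in> V"
  shows "branches T v = S v ` {c. (v, c) \<in> E}"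
proof -
  interpret D: wf_digraph "pre_digraph.del_vert (with_proj T) v" by (rule wf_digraph_del)
  have "branches T v = S v ` (V - {v})"
    unfolding branches_def D.sccs_verts_conv_scc_of branch_of_def by (simp add: pre_digraph.del_vert_simps)
  also have "\<dots> = S v ` {c. (v, c) \<in> E}"
  proof (intro equalityI subsetI)
    fix B assume "B \<in> S v ` (V - {v})"
    then obtain x where x: "x \<in> V" "x \<noteq> v" "B = S v x" by auto
    then obtain c where "(v, c) \<in> E" "x \<in> S v c" using branch_containing assms by blast
    then show "B \<in> S v ` {c. (v, c) \<in> E}" using branch_eq x by blast
  next
    fix B assume "B \<in> S v ` {c. (v, c) \<in> E}"
    then show "B \<in> S v ` (V - {v})" using arc_vertices arc_irrefl by auto
  qed
  finally show ?thesis .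
qed

text \<open>
  The orientation of all edges away from the root \<open>v\<close>: the head of an arc lies on the far side from \<open>v\<close>,
  so \<open>S p c\<close> is the set of vertices that the edge cuts off from \<open>v\<close>.
\<close>

definition arcs_away :: "'a \<Rightarrow> ('a \<times> 'a) set" where
  "arcs_away v = {(p, c) \<in> E. v \<notin> S p c}"

lemma finite_arcs_away [simp]: "finite (arcs_away v)"
  by (rule finite_subset[OF _ finite_arcs]) (auto simp: arcs_away_def)

lemma in_arcs_away: "(p, c) \<in> arcs_away v \<longleftrightarrow> (p, c) \<in> E \<and> v \<notin> S p c"
  by (simp add: arcs_away_def)

lemma swap_arcs_away:
  assumes "v \<in> V"
  shows "(p, c) \<in> E - arcs_away v \<longleftrightarrow> (c, p) \<in> arcs_away v"
  using assms branch_complement[of p c] branch_complement[of c p] arc_sym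
  by (auto simp: in_arcs_away)

lemma branch_separates_arc:
  assumes "(p, c) \<in> E" "(x, y) \<in> E" "x \<in> S p c" "y \<notin> S p c"
  shows "p = y \<and> c = x"
  using arc_leaving_branch[OF assms(1,3,2,4)] by simp

text \<open>
  The arcs of the sum are those on the path from \<open>v\<close> to \<open>x\<close>, since these are the edges that cut \<open>x\<close> off
  from \<open>v\<close>. The proof needs no paths: along an arc between \<open>x\<close> and \<open>y\<close> the index set changes by just
  this arc, because no other branch separates \<open>x\<close> from \<open>y\<close>.
\<close>

lemma potential_telescopes:
  fixes z :: "'a \<Rightarrow> real"
  assumes v: "v \<in> V" and "x \<in> V"
  shows "z x - z v = (\<Sum>(p, c) | (p, c) \<in> arcs_away v \<and> x \<in> S p c. z c - z p)"
proof -
  define F where "F x = {(p, c). (p, c) \<in> arcs_away v \<and> x \<in> S p c}" for x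
  have fin: "finite (F x)" for x
    by (rule finite_subset[OF _ finite_arcs_away[of v]]) (auto simp: F_def)
  define P where "P = {x. z x - z v = (\<Sum>(p, c) \<in> F x. z c - z p)}"
  have step: "F x = insert (y, x) (F y)" "(y, x) \<notin> F y"
    if xy: "(x, y) \<in> E" "v \<notin> S y x" for x y
  proof -
    have yx: "(y, x) \<in> E" using xy arc_sym by blast
    then have v': "v \<in> S x y" using xy v branch_complement[OF yx] by blast
    show "F x = insert (y, x) (F y)"
      using branch_separates_arc[OF _ xy(1)] branch_separates_arc[OF _ yx]
        v' xy(2) yx arc_root_in_branch[OF yx]
      by (fastforce simp: F_def in_arcs_away)
    show "(y, x) \<notin> F y" by (simp add: F_def)
  qed
  have "V \<subseteq> P"
  proof (rule arc_closed_set_is_everything)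
    have "F v = {}" by (auto simp: F_def in_arcs_away)
    then show "v \<in> P" by (simp add: P_def)
    fix a b assume ab: "(a, b) \<in> E" "a \<in> P"
    show "b \<in> P"
    proof (cases "v \<in> S a b")
      case False
      then show ?thesis
        using step[of b a] ab arc_sym[OF ab(1)] fin[of a] by (simp add: P_def)
    next
      case True
      then have "v \<notin> S b a" using branch_complement[OF ab(1)] by blast
      then show ?thesis
        using step[of a b] ab fin[of b] by (simp add: P_def)
    qed
  qed (rule v)
  then show ?thesis using \<open>x \<in> V\<close> by (auto simp: P_def F_def)
qed

lemma potential_telescopes_if:
  fixes z :: "'a \<Rightarrow> real"
  assumes "v \<in> V" and "x \<in> V"
  shows "z x - z v = (\<Sum>(p, c)\<in>arcs_away v. if x \<in> S p c then z c - z p else 0)"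
  unfolding potential_telescopes[OF assms, of z]
  by (simp add: case_prod_beta) (intro sum.mono_neutral_cong_left, auto)

lemma branch_nested:
  assumes "(p, c) \<in> E" "(v, d) \<in> E" "v \<notin> S p c" "c \<in> S v d"
  shows "S p c \<subseteq> S v d"
  by (rule branch_least) (use assms branch_step in blast)+

text \<open>
  This orients all edges except \<open>{u, v}\<close> away from that edge. It is the common part of the orientations
  away from \<open>u\<close> and away from \<open>v\<close>, which differ only in the direction of \<open>{u, v}\<close>.
\<close>

definition arcs_away_from_edge :: "'a \<Rightarrow> 'a \<Rightarrow> ('a \<times> 'a) set" where
  "arcs_away_from_edge u v = {(p, c) \<in> E. u \<notin> S p c \<and> v \<notin> S p c}"

lemma arcs_away_from_edge_commute: "arcs_away_from_edge u v = arcs_away_from_edge v u"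
  by (auto simp: arcs_away_from_edge_def)

lemma finite_arcs_away_from_edge [simp]: "finite (arcs_away_from_edge u v)"
  by (rule finite_subset[OF _ finite_arcs]) (auto simp: arcs_away_from_edge_def)

lemma arcs_away_endpoint:
  assumes "(u, v) \<in> E"
  shows "arcs_away u = insert (u, v) (arcs_away_from_edge u v)"
    and "(u, v) \<notin> arcs_away_from_edge u v"
proof -
  have vu: "(v, u) \<in> E" using assms arc_sym by blast
  show "(u, v) \<notin> arcs_away_from_edge u v"
    using arc_root_in_branch[OF assms] by (simp add: arcs_away_from_edge_def)
  show "arcs_away u = insert (u, v) (arcs_away_from_edge u v)"
    using branch_separates_arc[OF _ vu] assms
    by (fastforce simp: arcs_away_from_edge_def arcs_away_def)
qed

text \<open>
  A branch is connected, and only the edge \<open>{u, v}\<close> links the two sides.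
\<close>

lemma branch_in_side_of_edge:
  assumes uv: "(u, v) \<in> E" and pc: "(p, c) \<in> arcs_away_from_edge u v"
  shows "S p c \<subseteq> S u v \<or> S p c \<subseteq> S v u"
proof -
  have pc': "(p, c) \<in> E" "u \<notin> S p c" "v \<notin> S p c"
    using pc by (auto simp: arcs_away_from_edge_def)
  have "c \<in> S u v \<or> c \<in> S v u"
    using branch_complement[OF uv] arc_vertices[OF pc'(1)] by blast
  then show ?thesis
    using branch_nested[OF pc'(1) uv pc'(2)] branch_nested[OF pc'(1) arc_sym[OF uv] pc'(3)] by blast
qed

text \<open>
  If \<open>S v (f v)\<close> is as small as possible among the branches \<open>S v (f v)\<close>, then the one chosen at
  \<open>f v\<close> cannot lie strictly inside it. This is what would happen if \<open>f (f v)\<close> were different from \<open>v\<close>.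
\<close>

lemma neighbour_choice_reversed_somewhere:
  assumes "V \<noteq> {}" "\<And>v. v \<in> V \<Longrightarrow> (v, f v) \<in> E"
  obtains v where "v \<in> V" "f (f v) = v"
proof -
  obtain v where v: "v \<in> V" "\<And>u. u \<in> V \<Longrightarrow> card (S v (f v)) \<le> card (S u (f u))"
    using arg_min_if_finite[of V "\<lambda>v. card (S v (f v))"] assms(1)
    by (metis finite_verts linorder_not_le)
  have vu: "(v, f v) \<in> E" by (rule assms(2)[OF v(1)])
  then have u: "f v \<in> V" by (rule arc_vertices)
  have uw: "(f v, f (f v)) \<in> E" by (rule assms(2)[OF u])
  have "f (f v) = v"
  proof (rule ccontr)
    assume ne: "f (f v) \<noteq> v"
    have "f (f v) \<in> S v (f v)"
      using branch_step[OF arc_root_in_branch[OF vu] uw ne] .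
    moreover have "v \<notin> S (f v) (f (f v))"
      using branch_attached_once[OF uw arc_sym[OF vu]] ne by metis
    ultimately have "S (f v) (f (f v)) \<subseteq> S v (f v)"
      using branch_nested[OF uw vu] by blast
    moreover have "f v \<in> S v (f v) - S (f v) (f (f v))"
      using arc_root_in_branch[OF vu] by simp
    ultimately have "S (f v) (f (f v)) \<subset> S v (f v)" by blast
    then show False using v(2)[OF u] psubset_card_mono[OF finite_branch] by (metis leD)
  qed
  then show ?thesis using that v(1) by blast
qed

end

section \<open>Energy and shared resistance\<close>

locale weighted_tree = finite_tree +
  fixes w :: "'a \<Rightarrow> 'a \<Rightarrow> real"
  assumes w_sym: "w a b = w b a"
    and w_pos: "(a, b) \<in> E \<Longrightarrow> 0 < w a b"
begin

definition lap :: "'a \<Rightarrow> 'a \<Rightarrow> real" where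
  "lap x y = (if x = y then (\<Sum>c | (y, c) \<in> E. w y c) else if (x, y) \<in> E then - w x y else 0)"

lemma lap_sym: "lap x y = lap y x"
  unfolding lap_def using arc_sym w_sym by auto

lemma finite_neighbours [simp]: "finite {c. (x, c) \<in> E}"
  by (rule finite_subset[OF _ finite_verts]) (use arc_vertices in blast)

lemma lap_apply:
  assumes "x \<in> V"
  shows "(\<Sum>y\<in>V. lap x y * z y) = (\<Sum>y | (x, y) \<in> E. w x y * (z x - z y))"
proof -
  have "(\<Sum>y\<in>V. lap x y * z y) = lap x x * z x + (\<Sum>y\<in>V - {x}. lap x y * z y)"
    using assms by (simp add: sum.remove)
  also have "(\<Sum>y\<in>V - {x}. lap x y * z y) = (\<Sum>y | (x, y) \<in> E. - w x y * z y)"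
    by (rule sum.mono_neutral_cong_right)
       (use arc_vertices arc_irrefl in \<open>auto simp: lap_def\<close>)
  also have "lap x x * z x = (\<Sum>y | (x, y) \<in> E. w x y * z x)"
    by (simp add: lap_def sum_distrib_right)
  finally show ?thesis by (simp add: sum.distrib [symmetric] algebra_simps sum_subtractf)
qed

lemma sum_over_arcs: "(\<Sum>x\<in>V. \<Sum>y | (x, y) \<in> E. f x y) = (\<Sum>(x, y)\<in>E. f x y)"
proof -
  have "E = (SIGMA x:V. {y. (x, y) \<in> E})" using arc_vertices by auto
  then show ?thesis by (subst (2) \<open>E = _\<close>) (simp add: sum.Sigma)
qed

lemma sum_arcs_swap: "(\<Sum>(x, y)\<in>E. f x y) = (\<Sum>(x, y)\<in>E. f y x)"
  by (rule sum.reindex_bij_witness[of _ prod.swap prod.swap]) (use arc_sym in auto)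

lemma sum_lap_eq_0: "(\<Sum>x\<in>V. \<Sum>y\<in>V. lap x y * z y) = 0"
proof -
  have "(\<Sum>x\<in>V. \<Sum>y\<in>V. lap x y * z y) = (\<Sum>(x, y)\<in>E. w x y * (z x - z y))"
    by (simp add: lap_apply sum_over_arcs)
  moreover have "\<dots> = (\<Sum>(x, y)\<in>E. w y x * (z y - z x))" by (rule sum_arcs_swap)
  moreover have "\<dots> = - (\<Sum>(x, y)\<in>E. w x y * (z x - z y))"
    by (simp add: sum_negf [symmetric] case_prod_beta w_sym[of "snd _"] algebra_simps)
  ultimately show ?thesis by linarith
qed

text \<open>
  The flows inside the branch cancel in pairs, and only the edge to \<open>p\<close> leaves the branch.
\<close>

lemma sum_lap_branch:
  assumes pc: "(p, c) \<in> E"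
  shows "(\<Sum>x\<in>S p c. \<Sum>y\<in>V. lap x y * z y) = w p c * (z c - z p)"
proof -
  let ?B = "S p c"
  let ?g = "\<lambda>(x, y). w x y * (z x - z y)"
  define I where "I = {(x, y) \<in> E. x \<in> ?B \<and> y \<in> ?B}"
  have finI: "finite I" by (rule finite_subset[OF _ finite_arcs]) (auto simp: I_def)
  have cp: "(c, p) \<in> E" using pc arc_sym by blast
  have "(SIGMA x:?B. {y. (x, y) \<in> E}) = insert (c, p) I"
    using branch_separates_arc[OF pc] arc_root_in_branch[OF pc] cp by (auto simp: I_def)
  then have "(\<Sum>x\<in>?B. \<Sum>y\<in>V. lap x y * z y) = (\<Sum>a\<in>insert (c, p) I. ?g a)"
    using branch_in_verts by (simp add: lap_apply sum.Sigma)
  also have "\<dots> = w c p * (z c - z p) + (\<Sum>a\<in>I. ?g a)"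
    using finI by (simp add: I_def)
  also have "(\<Sum>a\<in>I. ?g a) = (\<Sum>(x, y)\<in>I. w y x * (z y - z x))"
    by (rule sum.reindex_bij_witness[of _ prod.swap prod.swap]) (use arc_sym in \<open>auto simp: I_def\<close>)
  then have "(\<Sum>a\<in>I. ?g a) = - (\<Sum>a\<in>I. ?g a)"
    by (simp add: sum_negf [symmetric] case_prod_beta w_sym[of "snd _"] algebra_simps)
  then have "(\<Sum>a\<in>I. ?g a) = 0" by linarith
  finally show ?thesis by (simp add: w_sym)
qed

definition energy :: "('a \<Rightarrow> real) \<Rightarrow> real" where
  "energy z = (\<Sum>x\<in>V. \<Sum>y\<in>V. z x * lap x y * z y)"

text \<open>
  Summation by parts counts every edge twice, once in each direction, and the orientation away from
  \<open>v\<close> contains exactly one of the two directions.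
\<close>

lemma energy_arcs_away:
  assumes "v \<in> V"
  shows "energy z = (\<Sum>(p, c)\<in>arcs_away v. w p c * (z c - z p)\<^sup>2)"
proof -
  let ?f = "\<lambda>x y. w x y * (z x - z y)\<^sup>2"
  have "energy z = (\<Sum>x\<in>V. z x * (\<Sum>y\<in>V. lap x y * z y))"
    by (simp add: energy_def sum_distrib_left mult.assoc)
  also have "\<dots> = (\<Sum>(x, y)\<in>E. w x y * z x * (z x - z y))"
    unfolding sum_over_arcs [symmetric]
    by (intro sum.cong refl) (simp add: lap_apply, simp add: sum_distrib_left mult_ac)
  finally have e1: "energy z = \<dots>" .
  also have "\<dots> = (\<Sum>(x, y)\<in>E. w y x * z y * (z y - z x))" by (rule sum_arcs_swap)
  finally have "2 * energy z = (\<Sum>(x, y)\<in>E. w x y * z x * (z x - z y) + w y x * z y * (z y - z x))"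
    using e1 by (simp add: sum.distrib case_prod_beta)
  also have "\<dots> = (\<Sum>(x, y)\<in>E. ?f x y)"
    by (rule sum.cong) (auto simp: w_sym power2_eq_square algebra_simps)
  also have "\<dots> = (\<Sum>(x, y)\<in>E - arcs_away v. ?f x y) + (\<Sum>(x, y)\<in>arcs_away v. ?f x y)"
    by (rule sum.subset_diff) (auto simp: arcs_away_def)
  also have "(\<Sum>(x, y)\<in>E - arcs_away v. ?f x y) = (\<Sum>(x, y)\<in>arcs_away v. ?f x y)"
  proof (rule sum.reindex_bij_witness[of _ prod.swap prod.swap])
    have swap: "a \<in> E - arcs_away v \<longleftrightarrow> prod.swap a \<in> arcs_away v" for a
      using swap_arcs_away[OF assms] by (cases a) simp
    show "prod.swap a \<in> arcs_away v" if "a \<in> E - arcs_away v" for a using swap that by blast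
    show "prod.swap b \<in> E - arcs_away v" if "b \<in> arcs_away v" for b
      using swap[of "prod.swap b"] that by simp
    show "(case prod.swap a of (x, y) \<Rightarrow> ?f x y) = (case a of (x, y) \<Rightarrow> ?f x y)" for a
      using w_sym by (cases a) (simp add: power2_commute)
  qed auto
  finally show ?thesis
    by (simp add: power2_commute)
qed

text \<open>
  The resistance of the common part of the paths from \<open>x\<close> and from \<open>y\<close> to \<open>v\<close>. This is the \<open>(x, y)\<close> entry
  of the bottleneck matrices at \<open>v\<close>. An edge lies on both paths if and only if it cuts off both
  vertices from \<open>v\<close>.
\<close>

definition shared_resistance :: "'a \<Rightarrow> 'a \<Rightarrow> 'a \<Rightarrow> real" where
  "shared_resistance v x y = (\<Sum>(p, c)\<in>arcs_away v. if x \<in> S p c \<and> y \<in> S p c then 1 / w p c else 0)"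

lemma shared_resistance_sym: "shared_resistance v x y = shared_resistance v y x"
  unfolding shared_resistance_def by (simp add: conj_commute)

text \<open>
  The product is computed column by column. Applied to an indicator \<open>z\<close>, the Laplacian sums over a
  branch to the flow through one edge, so that the product becomes the telescoping sum for \<open>z x - z v\<close>.
\<close>

lemma shared_resistance_inverse:
  assumes v: "v \<in> V" and x: "x \<in> V - {v}" and y: "y \<in> V - {v}"
  shows "(\<Sum>a\<in>V - {v}. shared_resistance v x a * lap a y) = (if x = y then 1 else 0)"
proof -
  \<comment> \<open>the indicator of \<open>y\<close>, whose image under the Laplacian is the column \<open>y\<close>\<close>
  define z where "z a = (if a = y then 1 else 0 :: real)" for a
  have lz: "(\<Sum>b\<in>V. lap a b * z b) = lap a y" for a
    using y by (simp add: z_def if_distrib cong: if_cong)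
  have "(\<Sum>a\<in>V - {v}. shared_resistance v x a * lap a y)
      = (\<Sum>a\<in>V - {v}. \<Sum>(p, c)\<in>arcs_away v.
          if x \<in> S p c then (if a \<in> S p c then lap a y else 0) / w p c else 0)"
    unfolding shared_resistance_def sum_distrib_right by (intro sum.cong refl) (auto simp: case_prod_beta)
  also have "\<dots> = (\<Sum>(p, c)\<in>arcs_away v.
          if x \<in> S p c then (\<Sum>a\<in>V - {v}. if a \<in> S p c then lap a y else 0) / w p c else 0)"
    by (subst sum.swap) (intro sum.cong refl, auto simp: sum_divide_distrib)
  also have "\<dots> = (\<Sum>(p, c)\<in>arcs_away v. if x \<in> S p c then z c - z p else 0)"
  proof (intro sum.cong refl, safe)
    fix p c assume pc: "(p, c) \<in> arcs_away v"
    then have pc': "(p, c) \<in> E" "v \<notin> S p c" by (auto simp: in_arcs_away)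
    have "(\<Sum>a\<in>V - {v}. if a \<in> S p c then lap a y else 0) = (\<Sum>a\<in>S p c. lap a y)"
      by (rule sum.mono_neutral_cong_right) (use pc' branch_in_verts in auto)
    also have "\<dots> = w p c * (z c - z p)" using sum_lap_branch[OF pc'(1), of z] by (simp add: lz)
    finally show "(if x \<in> S p c then (\<Sum>a\<in>V - {v}. if a \<in> S p c then lap a y else 0) / w p c else 0)
        = (if x \<in> S p c then z c - z p else 0)"
      using w_pos[OF pc'(1)] by simp
  qed
  also have "\<dots> = z x - z v"
    using potential_telescopes_if[OF v, of x z] x by simp
  finally show ?thesis using y by (auto simp: z_def)
qed

text \<open>
  The factorisation \<open>R\<^sup>T R\<close> of the bottleneck matrix, in the form of a sum of squares.
\<close>

lemma shared_resistance_quadratic: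
  "(\<Sum>x\<in>X. \<Sum>y\<in>X. shared_resistance v x y * q x * q y)
    = (\<Sum>(p, c)\<in>arcs_away v. (\<Sum>x\<in>X. if x \<in> S p c then q x else 0)\<^sup>2 / w p c)"
proof -
  have "(\<Sum>x\<in>X. \<Sum>y\<in>X. shared_resistance v x y * q x * q y)
      = (\<Sum>x\<in>X. \<Sum>y\<in>X. \<Sum>(p, c)\<in>arcs_away v.
          (if x \<in> S p c then q x else 0) * (if y \<in> S p c then q y else 0) / w p c)"
    unfolding shared_resistance_def sum_distrib_right by (intro sum.cong refl) auto
  also have "\<dots> = (\<Sum>a\<in>arcs_away v. \<Sum>x\<in>X. \<Sum>y\<in>X. case a of (p, c) \<Rightarrow>
          (if x \<in> S p c then q x else 0) * (if y \<in> S p c then q y else 0) / w p c)"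
    by (simp add: sum.swap[of _ X "arcs_away v"])
  also have "\<dots> = (\<Sum>(p, c)\<in>arcs_away v. (\<Sum>x\<in>X. if x \<in> S p c then q x else 0)\<^sup>2 / w p c)"
    by (intro sum.cong refl)
       (auto simp: power2_eq_square sum_product sum_divide_distrib)
  finally show ?thesis .
qed

lemma shared_resistance_different_branches:
  assumes v: "v \<in> V" and vc: "(v, c) \<in> E" and xy: "x \<in> S v c" "y \<notin> S v c"
  shows "shared_resistance v x y = 0"
proof -
  have "\<not> (x \<in> S p d \<and> y \<in> S p d)" if "(p, d) \<in> arcs_away v" for p d
  proof
    assume xy': "x \<in> S p d \<and> y \<in> S p d"
    have pd: "(p, d) \<in> E" "v \<notin> S p d" using that by (auto simp: in_arcs_away)
    then obtain e where e: "(v, e) \<in> E" "d \<in> S v e"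
      using branch_containing[OF v, of d] arc_vertices arc_root_in_branch by metis
    then have "S p d \<subseteq> S v e" using branch_nested pd by blast
    then show False using xy xy' branches_disjoint[OF vc e(1), of x] by blast
  qed
  then show ?thesis unfolding shared_resistance_def by (auto intro!: sum.neutral)
qed

lemma shared_resistance_pos:
  assumes "v \<in> V" "x \<in> V - {v}"
  shows "0 < shared_resistance v x x"
proof -
  obtain c where c: "(v, c) \<in> E" "x \<in> S v c" using branch_containing assms by blast
  then have "(v, c) \<in> arcs_away v" by (simp add: in_arcs_away)
  then show ?thesis unfolding shared_resistance_def
    by (rule sum_pos2[rotated]) (use c w_pos in \<open>auto simp: in_arcs_away less_imp_le\<close>)
qed

end

section \<open>Bounding a potential by its energy\<close>

text \<open>
  This is the passage from \<open>R\<^sup>T R\<close> to \<open>R R\<^sup>T\<close>. The rows of \<open>R\<close> are the indicators of the sets \<open>D c\<close>, scaled by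
  \<open>sqrt (r c)\<close>, and \<open>z\<close> is \<open>R\<^sup>T\<close> applied to \<open>d c / sqrt (r c)\<close>. By Cauchy and Schwarz, the squared norm of \<open>z\<close> is at
  most the norm of that vector times the norm of \<open>R z\<close>, and the latter is bounded in terms of \<open>z\<close> itself.
\<close>

lemma potential_bound:
  fixes \<rho> :: real and D :: "'c \<Rightarrow> 'x set"
  assumes fin: "finite X" "finite C"
    and r: "\<And>c. c \<in> C \<Longrightarrow> 0 < r c" and \<rho>: "0 \<le> \<rho>"
    and bound: "\<And>q. (\<Sum>c\<in>C. r c * (\<Sum>x\<in>X. if x \<in> D c then q x else 0)\<^sup>2) \<le> \<rho> * (\<Sum>x\<in>X. (q x)\<^sup>2)"
    and z: "\<And>x. x \<in> X \<Longrightarrow> z x = (\<Sum>c\<in>C. if x \<in> D c then d c else 0)"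
  shows "(\<Sum>x\<in>X. (z x)\<^sup>2) \<le> \<rho> * (\<Sum>c\<in>C. (d c)\<^sup>2 / r c)"
proof -
  let ?Z = "\<Sum>x\<in>X. (z x)\<^sup>2"
  let ?W = "\<Sum>c\<in>C. (d c)\<^sup>2 / r c"
  define R where "R c = (\<Sum>x\<in>X. if x \<in> D c then z x else 0)" for c
  have W: "0 \<le> ?W" by (intro sum_nonneg divide_nonneg_pos) (use r in auto)
  have "?Z = (\<Sum>x\<in>X. \<Sum>c\<in>C. z x * (if x \<in> D c then d c else 0))"
    by (intro sum.cong refl) (simp add: z power2_eq_square sum_distrib_left)
  also have "\<dots> = (\<Sum>c\<in>C. d c * R c)"
    by (subst sum.swap) (auto simp: R_def sum_distrib_left intro!: sum.cong)
  also have "\<dots> = (\<Sum>c\<in>C. (d c / sqrt (r c)) * (sqrt (r c) * R c))"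
    using r by (intro sum.cong refl) (auto dest: r)
  finally have "?Z\<^sup>2 \<le> (\<Sum>c\<in>C. (d c / sqrt (r c))\<^sup>2) * (\<Sum>c\<in>C. (sqrt (r c) * R c)\<^sup>2)"
    using Cauchy_Schwarz_ineq_sum[of "\<lambda>c. d c / sqrt (r c)" "\<lambda>c. sqrt (r c) * R c" C] by simp
  also have "\<dots> = ?W * (\<Sum>c\<in>C. r c * (R c)\<^sup>2)"
    by (intro arg_cong2[of _ _ _ _ "(*)"] sum.cong refl)
       (auto simp: power_divide power_mult_distrib dest!: r)
  also have "\<dots> \<le> ?W * (\<rho> * ?Z)"
    using bound[of z] W unfolding R_def by (intro mult_left_mono)
  finally have *: "?Z * ?Z \<le> \<rho> * ?W * ?Z" by (simp add: power2_eq_square mult_ac)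
  show ?thesis
  proof (cases "?Z = 0")
    case True
    then show ?thesis using W \<rho> by simp
  next
    case False
    then have "0 < ?Z" using sum_nonneg[of X "\<lambda>x. (z x)\<^sup>2"] by (simp add: order_less_le)
    then show ?thesis using * by simp
  qed
qed

lemma shift_increases_norm:
  fixes z :: "'x \<Rightarrow> real"
  assumes "(\<Sum>x\<in>X. z x) = 0"
  shows "(\<Sum>x\<in>X. (z x)\<^sup>2) \<le> (\<Sum>x\<in>X. (z x - c)\<^sup>2)"
proof -
  have "(\<Sum>x\<in>X. (z x - c)\<^sup>2) = (\<Sum>x\<in>X. (z x)\<^sup>2 - (2 * c) * z x + c\<^sup>2)"
    by (intro sum.cong refl) (simp add: power2_diff)
  also have "\<dots> = (\<Sum>x\<in>X. (z x)\<^sup>2) - (2 * c) * (\<Sum>x\<in>X. z x) + (\<Sum>x\<in>X. c\<^sup>2)"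
    by (simp only: sum.distrib sum_subtractf sum_distrib_left[symmetric])
  finally have "(\<Sum>x\<in>X. (z x - c)\<^sup>2) = (\<Sum>x\<in>X. (z x)\<^sup>2) - (2 * c) * (\<Sum>x\<in>X. z x) + (\<Sum>x\<in>X. c\<^sup>2)" .
  then show ?thesis using assms by (simp add: sum_nonneg)
qed

context weighted_tree
begin

text \<open>
  The potential \<open>z - z v\<close> is the telescoping sum of its differences, each with resistance \<open>1 / w p c\<close>, and
  replacing \<open>z\<close> by it does not decrease the norm because \<open>z\<close> is orthogonal to the constants.
\<close>

lemma vertex_bound:
  assumes v: "v \<in> V" and \<rho>: "0 \<le> \<rho>"
    and bound: "\<And>q. (\<Sum>x\<in>V - {v}. \<Sum>y\<in>V - {v}. shared_resistance v x y * q x * q y)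
      \<le> \<rho> * (\<Sum>x\<in>V - {v}. (q x)\<^sup>2)"
    and z: "(\<Sum>x\<in>V. z x) = 0"
  shows "(\<Sum>x\<in>V. (z x)\<^sup>2) \<le> \<rho> * energy z"
proof -
  have "(\<Sum>x\<in>V. (z x)\<^sup>2) \<le> (\<Sum>x\<in>V. (z x - z v)\<^sup>2)" by (rule shift_increases_norm[OF z])
  also have "\<dots> = (\<Sum>x\<in>V - {v}. (z x - z v)\<^sup>2)"
    using v by (simp add: sum.remove)
  also have "\<dots> \<le> \<rho> * (\<Sum>(p, c)\<in>arcs_away v. (z c - z p)\<^sup>2 / (1 / w p c))"
  proof -
    have "(\<Sum>x\<in>V - {v}. (z x - z v)\<^sup>2) \<le>
      \<rho> * (\<Sum>a\<in>arcs_away v. (case a of (p, c) \<Rightarrow> z c - z p)\<^sup>2 / (case a of (p, c) \<Rightarrow> 1 / w p c))"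
    proof (rule potential_bound[where D = "\<lambda>(p, c). S p c"])
      fix q
      show "(\<Sum>a\<in>arcs_away v. (case a of (p, c) \<Rightarrow> 1 / w p c) *
          (\<Sum>x\<in>V - {v}. if x \<in> (case a of (p, c) \<Rightarrow> S p c) then q x else 0)\<^sup>2)
        \<le> \<rho> * (\<Sum>x\<in>V - {v}. (q x)\<^sup>2)"
        using bound[of q] by (simp add: shared_resistance_quadratic case_prod_beta)
    next
      fix x assume "x \<in> V - {v}"
      then show "z x - z v = (\<Sum>a\<in>arcs_away v.
          if x \<in> (case a of (p, c) \<Rightarrow> S p c) then case a of (p, c) \<Rightarrow> z c - z p else 0)"
        using potential_telescopes_if[OF v, of x z] by (auto simp: case_prod_unfold intro!: sum.cong)
    qed (use \<rho> w_pos in \<open>auto simp: in_arcs_away\<close>)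
    then show ?thesis by (simp add: case_prod_beta)
  qed
  also have "\<dots> = \<rho> * energy z" by (simp add: energy_arcs_away[OF v] mult_ac)
  finally show ?thesis .
qed

text \<open>
  All vertices of the branch lie behind \<open>{u, v}\<close>, so subtracting a constant from all entries only
  shortens the resistance of this edge.
\<close>

lemma shared_resistance_minus_quadratic:
  assumes uv: "(u, v) \<in> E" and X: "X \<subseteq> S u v"
  shows "(\<Sum>x\<in>X. \<Sum>y\<in>X. (shared_resistance u x y - t / w u v) * q x * q y)
    = (\<Sum>(p, c)\<in>arcs_away_from_edge u v. (\<Sum>x\<in>X. if x \<in> S p c then q x else 0)\<^sup>2 / w p c)
      + (1 - t) / w u v * (\<Sum>x\<in>X. q x)\<^sup>2"
proof -
  have "(\<Sum>x\<in>X. \<Sum>y\<in>X. (shared_resistance u x y - k) * q x * q y)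
    = (\<Sum>x\<in>X. \<Sum>y\<in>X. shared_resistance u x y * q x * q y) - k * (\<Sum>x\<in>X. q x)\<^sup>2" for k
    by (simp add: left_diff_distrib sum_subtractf power2_eq_square sum_product
        sum_distrib_left[symmetric] mult.assoc)
  note this[of "t / w u v"]
  also have "(\<Sum>x\<in>X. if x \<in> S u v then q x else 0) = (\<Sum>x\<in>X. q x)"
    by (rule sum.cong) (use X in auto)
  then have "(\<Sum>x\<in>X. \<Sum>y\<in>X. shared_resistance u x y * q x * q y) = (\<Sum>x\<in>X. q x)\<^sup>2 / w u v +
    (\<Sum>(p, c)\<in>arcs_away_from_edge u v. (\<Sum>x\<in>X. if x \<in> S p c then q x else 0)\<^sup>2 / w p c)"
    unfolding shared_resistance_quadratic arcs_away_endpoint(1)[OF uv] using arcs_away_endpoint(2)[OF uv] by simp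
  finally show ?thesis by (simp add: algebra_simps diff_divide_distrib)
qed

text \<open>
  The edge \<open>{u, v}\<close> is cut at the point where the potential, interpolated linearly in the resistance, is
  \<open>c0 = \<nu> * z v + (1 - \<nu>) * z u\<close>. The two halves have the resistances \<open>(1 - \<nu>) / w u v\<close> on the side of \<open>v\<close>
  and \<open>\<nu> / w u v\<close> on the side of \<open>u\<close>, and together they carry the same energy as the edge. The tree
  rooted at the cut point consists of both sides, which do not interact, so \<open>potential_bound\<close> applies
  to it. The arcs \<open>(u, v)\<close> and \<open>(v, u)\<close> stand for the two half edges.
\<close>

lemma edge_bound:
  assumes uv: "(u, v) \<in> E" and \<rho>: "0 \<le> \<rho>" and \<nu>: "0 < \<nu>" "\<nu> < 1"
    and bound_v: "\<And>q. (\<Sum>x\<in>S u v. \<Sum>y\<in>S u v. (shared_resistance u x y - \<nu> / w u v) * q x * q y)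
      \<le> \<rho> * (\<Sum>x\<in>S u v. (q x)\<^sup>2)"
    and bound_u: "\<And>q. (\<Sum>x\<in>S v u. \<Sum>y\<in>S v u. (shared_resistance v x y - (1 - \<nu>) / w v u) * q x * q y)
      \<le> \<rho> * (\<Sum>x\<in>S v u. (q x)\<^sup>2)"
    and z: "(\<Sum>x\<in>V. z x) = 0"
  shows "(\<Sum>x\<in>V. (z x)\<^sup>2) \<le> \<rho> * energy z"
proof -
  have vu: "(v, u) \<in> E" using uv arc_sym by blast
  have ne: "u \<noteq> v" using uv arc_irrefl by blast
  let ?K = "arcs_away_from_edge u v"
  let ?C = "insert (u, v) (insert (v, u) ?K)"
  have new: "(u, v) \<notin> insert (v, u) ?K" "(v, u) \<notin> ?K"
    using arcs_away_endpoint(2)[OF uv] arcs_away_endpoint(2)[OF vu] ne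
    unfolding arcs_away_from_edge_commute[of v u] by auto
  define r where "r a = (if a = (u, v) then (1 - \<nu>) / w u v
      else if a = (v, u) then \<nu> / w u v else 1 / w (fst a) (snd a))" for a
  define c0 where "c0 = \<nu> * z v + (1 - \<nu>) * z u"
  define d where "d a = (if a = (u, v) then z v - c0 else if a = (v, u) then z u - c0
      else z (snd a) - z (fst a))" for a
  have r0: "r a = 1 / w (fst a) (snd a)" "d a = z (snd a) - z (fst a)" if "a \<in> ?K" for a
    using that new by (auto simp: r_def d_def)
  have V: "V = S u v \<union> S v u" "S u v \<inter> S v u = {}"
    using branch_complement[OF uv] branch_in_verts by blast+
  have sumV: "(\<Sum>x\<in>V. f x) = (\<Sum>x\<in>S u v. f x) + (\<Sum>x\<in>S v u. f x)" for f :: "'a \<Rightarrow> real"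
    unfolding V(1) using V(2) by (simp add: sum.union_disjoint)
  have "(\<Sum>x\<in>V. (z x)\<^sup>2) \<le> (\<Sum>x\<in>V. (z x - c0)\<^sup>2)" by (rule shift_increases_norm[OF z])
  also have "\<dots> \<le> \<rho> * (\<Sum>a\<in>?C. (d a)\<^sup>2 / r a)"
  proof (rule potential_bound[where D = "\<lambda>(p, c). S p c"])
    fix a assume "a \<in> ?C"
    then show "0 < r a" using \<nu> w_pos uv vu
      by (auto simp: r_def arcs_away_from_edge_def)
  next
    fix q :: "'a \<Rightarrow> real"
    let ?q = "\<lambda>X p c. \<Sum>x\<in>X. if x \<in> S p c then q x else 0"
    have q_uv: "?q V u v = (\<Sum>x\<in>S u v. q x)" "?q V v u = (\<Sum>x\<in>S v u. q x)"
      by (rule sum.mono_neutral_cong_right; use branch_in_verts in auto)+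
    \<comment> \<open>a branch that avoids \<open>u\<close> and \<open>v\<close> lies on one side, so no cross terms arise\<close>
    have side: "(?q V p c)\<^sup>2 = (?q (S u v) p c)\<^sup>2 + (?q (S v u) p c)\<^sup>2" if "(p, c) \<in> ?K" for p c
    proof -
      have "?q (S u v) p c = 0 \<or> ?q (S v u) p c = 0"
        using branch_in_side_of_edge[OF uv that]
      proof
        assume "S p c \<subseteq> S u v"
        then have "?q (S v u) p c = 0" using V(2) by (intro sum.neutral) auto
        then show ?thesis ..
      next
        assume "S p c \<subseteq> S v u"
        then have "?q (S u v) p c = 0" using V(2) by (intro sum.neutral) auto
        then show ?thesis ..
      qed
      then show ?thesis unfolding sumV by auto
    qed
    have "(\<Sum>a\<in>?C. r a * (?q V (fst a) (snd a))\<^sup>2)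
      = (1 - \<nu>) / w u v * (\<Sum>x\<in>S u v. q x)\<^sup>2 + \<nu> / w u v * (\<Sum>x\<in>S v u. q x)\<^sup>2
        + (\<Sum>a\<in>?K. r a * (?q V (fst a) (snd a))\<^sup>2)"
      using new by (simp add: q_uv r_def ne ne[symmetric])
    also have "(\<Sum>a\<in>?K. r a * (?q V (fst a) (snd a))\<^sup>2)
      = (\<Sum>(p, c)\<in>?K. (?q (S u v) p c)\<^sup>2 / w p c) + (\<Sum>(p, c)\<in>?K. (?q (S v u) p c)\<^sup>2 / w p c)"
      unfolding sum.distrib[symmetric]
      by (rule sum.cong) (auto simp: r0 side add_divide_distrib)
    finally have "(\<Sum>a\<in>?C. r a * (?q V (fst a) (snd a))\<^sup>2)
      = (\<Sum>x\<in>S u v. \<Sum>y\<in>S u v. (shared_resistance u x y - \<nu> / w u v) * q x * q y)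
       + (\<Sum>x\<in>S v u. \<Sum>y\<in>S v u. (shared_resistance v x y - (1 - \<nu>) / w v u) * q x * q y)"
      unfolding shared_resistance_minus_quadratic[OF uv order_refl] shared_resistance_minus_quadratic[OF vu order_refl]
      by (simp add: arcs_away_from_edge_commute[of v u] w_sym[of v u])
    also have "\<dots> \<le> \<rho> * (\<Sum>x\<in>V. (q x)\<^sup>2)"
      using bound_v[of q] bound_u[of q] by (simp add: sumV distrib_left)
    finally show "(\<Sum>a\<in>?C. r a * (\<Sum>x\<in>V. if x \<in> (case a of (p, c) \<Rightarrow> S p c) then q x else 0)\<^sup>2)
        \<le> \<rho> * (\<Sum>x\<in>V. (q x)\<^sup>2)"
      by (simp add: case_prod_beta)
  next
    fix x assume x: "x \<in> V"
    let ?s = "\<Sum>(p, c) | (p, c) \<in> ?K \<and> x \<in> S p c. z c - z p"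
    have s: "(\<Sum>a\<in>?K. if x \<in> S (fst a) (snd a) then d a else 0) = ?s"
    proof -
      have "(\<Sum>a\<in>?K. if x \<in> S (fst a) (snd a) then d a else 0)
          = (\<Sum>a\<in>?K. if x \<in> S (fst a) (snd a) then z (snd a) - z (fst a) else 0)"
        by (rule sum.cong) (auto simp: r0)
      then show ?thesis by (simp add: sum.inter_filter[symmetric] case_prod_unfold)
    qed
    have tel: "z x - z a = ?s" if "(b, a) \<in> E" "{a, b} = {u, v}" "x \<in> S b a" for a b
    proof -
      have "x \<notin> S a b" using that(3) branch_complement[OF that(1)] by blast
      moreover have "arcs_away_from_edge a b = ?K"
        using that(2) arcs_away_from_edge_commute[of v u] by (auto simp: doubleton_eq_iff)
      ultimately have "{(p, c). (p, c) \<in> arcs_away a \<and> x \<in> S p c}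
          = {(p, c). (p, c) \<in> ?K \<and> x \<in> S p c}"
        using arcs_away_endpoint(1)[OF arc_sym[OF that(1)]] by auto
      then show ?thesis
        using potential_telescopes[OF arc_vertices(2)[OF that(1)] x, of z] by (simp add: case_prod_unfold)
    qed
    consider "x \<in> S u v" "x \<notin> S v u" | "x \<in> S v u" "x \<notin> S u v" using x V by blast
    then have "z x - c0 = (if x \<in> S u v then z v - c0 else 0) + (if x \<in> S v u then z u - c0 else 0) + ?s"
    proof cases
      case 1
      then show ?thesis using tel[OF uv insert_commute] by simp
    next
      case 2
      then show ?thesis using tel[OF vu refl] by simp
    qed
    moreover have "(\<Sum>a\<in>?C. if x \<in> S (fst a) (snd a) then d a else 0)
       = (if x \<in> S u v then d (u, v) else 0) + (if x \<in> S v u then d (v, u) else 0) + ?s"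
      using new by (simp add: s)
    moreover have "d (u, v) = z v - c0" "d (v, u) = z u - c0" using ne by (simp_all add: d_def)
    ultimately show "z x - c0 = (\<Sum>a\<in>?C. if x \<in> (case a of (p, c) \<Rightarrow> S p c) then d a else 0)"
      by (simp only: case_prod_beta)
  qed (use \<rho> in auto)
  also have "(\<Sum>a\<in>?C. (d a)\<^sup>2 / r a) = energy z"
  proof -
    have w0: "w u v > 0" using w_pos uv .
    have "(\<Sum>a\<in>?C. (d a)\<^sup>2 / r a) = (d (u, v))\<^sup>2 / r (u, v) + (d (v, u))\<^sup>2 / r (v, u)
        + (\<Sum>(p, c)\<in>?K. w p c * (z c - z p)\<^sup>2)"
      using new by (simp add: r0 case_prod_beta mult_ac)
    also have "(d (u, v))\<^sup>2 / r (u, v) + (d (v, u))\<^sup>2 / r (v, u) = w u v * (z v - z u)\<^sup>2"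
    proof -
      have "d (u, v) = (1 - \<nu>) * (z v - z u)" "d (v, u) = - \<nu> * (z v - z u)"
        using ne by (simp_all add: d_def c0_def algebra_simps)
      then have "(d (u, v))\<^sup>2 / r (u, v) = (1 - \<nu>) * (w u v * (z v - z u)\<^sup>2)"
          "(d (v, u))\<^sup>2 / r (v, u) = \<nu> * (w u v * (z v - z u)\<^sup>2)"
        using \<nu> w0 ne by (simp_all add: r_def power_mult_distrib power2_eq_square[of \<nu>]
            power2_eq_square[of "1 - \<nu>"])
      then show ?thesis by (simp add: algebra_simps)
    qed
    finally show ?thesis
      unfolding energy_arcs_away[OF arc_vertices(1)[OF uv]] arcs_away_endpoint(1)[OF uv]
      using new by simp
  qed
  finally show ?thesis .
qed

lemma sum_over_branches:
  assumes "v \<in> V"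
  shows "(\<Sum>x\<in>V - {v}. f x) = (\<Sum>c | (v, c) \<in> E. \<Sum>x\<in>S v c. f x)"
proof -
  have "V - {v} = (\<Union>c\<in>{c. (v, c) \<in> E}. S v c)"
  proof (intro equalityI subsetI)
    fix x assume "x \<in> V - {v}"
    then show "x \<in> (\<Union>c\<in>{c. (v, c) \<in> E}. S v c)" using branch_containing[OF assms, of x] by blast
  qed (use branch_subset in blast)
  moreover have "\<forall>c\<in>{c. (v, c) \<in> E}. \<forall>d\<in>{c. (v, c) \<in> E}. c \<noteq> d \<longrightarrow> S v c \<inter> S v d = {}"
    using branches_disjoint by blast
  ultimately show ?thesis by (simp only: sum.UNION_disjoint finite_neighbours finite_branch ball_simps simp_thms)
qed

lemma shared_resistance_block_diagonal:
  assumes v: "v \<in> V"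
  shows "(\<Sum>x\<in>V - {v}. \<Sum>y\<in>V - {v}. shared_resistance v x y * q x * q y)
    = (\<Sum>c | (v, c) \<in> E. \<Sum>x\<in>S v c. \<Sum>y\<in>S v c. shared_resistance v x y * q x * q y)"
proof -
  have block: "(\<Sum>y\<in>V - {v}. shared_resistance v x y * q x * q y) = (\<Sum>y\<in>S v c. shared_resistance v x y * q x * q y)"
    if c: "(v, c) \<in> E" "x \<in> S v c" for x c
  proof (rule sum.mono_neutral_right)
    show "\<forall>y\<in>V - {v} - S v c. shared_resistance v x y * q x * q y = 0"
      using shared_resistance_different_branches[OF v c] by simp
  qed (use branch_subset in auto)
  have "(\<Sum>x\<in>V - {v}. \<Sum>y\<in>V - {v}. shared_resistance v x y * q x * q y)
    = (\<Sum>c | (v, c) \<in> E. \<Sum>x\<in>S v c. \<Sum>y\<in>V - {v}. shared_resistance v x y * q x * q y)"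
    by (rule sum_over_branches[OF v])
  then show ?thesis by (simp add: block)
qed

text \<open>
  Removing the full resistance of \<open>{u, v}\<close> moves the root from \<open>v\<close> to \<open>u\<close>: what remains are the
  bottleneck matrices of the other branches at \<open>u\<close>, and zero at \<open>u\<close> itself.
\<close>

lemma shared_resistance_without_edge:
  assumes uv: "(u, v) \<in> E"
  shows "(\<Sum>x\<in>S v u. \<Sum>y\<in>S v u. (shared_resistance v x y - 1 / w v u) * q x * q y)
    = (\<Sum>c | (u, c) \<in> E \<and> c \<noteq> v. \<Sum>x\<in>S u c. \<Sum>y\<in>S u c. shared_resistance u x y * q x * q y)"
proof -
  define q' where "q' x = (if x \<in> S v u then q x else 0)" for x
  have vu: "(v, u) \<in> E" using uv arc_sym by blast
  have u: "u \<in> V" using arc_vertices uv by blast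
  have compl: "S v u = V - S u v" using branch_complement[OF uv] .
  have "(\<Sum>x\<in>S v u. \<Sum>y\<in>S v u. (shared_resistance v x y - 1 / w v u) * q x * q y)
    = (\<Sum>(p, c)\<in>arcs_away_from_edge u v. (\<Sum>x\<in>S v u. if x \<in> S p c then q x else 0)\<^sup>2 / w p c)"
    unfolding shared_resistance_minus_quadratic[OF vu order_refl] by (simp add: arcs_away_from_edge_commute[of v u])
  also have "\<dots> = (\<Sum>(p, c)\<in>arcs_away_from_edge u v.
      (\<Sum>x\<in>V - {u}. if x \<in> S p c then q' x else 0)\<^sup>2 / w p c)"
  proof (intro sum.cong refl, safe)
    fix p c assume "(p, c) \<in> arcs_away_from_edge u v"
    then have "u \<notin> S p c" by (simp add: arcs_away_from_edge_def)
    then have "(\<Sum>x\<in>S v u. if x \<in> S p c then q x else 0) = (\<Sum>x\<in>V - {u}. if x \<in> S p c then q' x else 0)"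
      by (intro sum.mono_neutral_cong) (use branch_in_verts in \<open>auto simp: q'_def\<close>)
    then show "(\<Sum>x\<in>S v u. if x \<in> S p c then q x else 0)\<^sup>2 / w p c
        = (\<Sum>x\<in>V - {u}. if x \<in> S p c then q' x else 0)\<^sup>2 / w p c" by simp
  qed
  also have "\<dots> = (\<Sum>x\<in>V - {u}. \<Sum>y\<in>V - {u}. shared_resistance u x y * q' x * q' y)"
  proof -
    have "(\<Sum>x\<in>V - {u}. if x \<in> S u v then q' x else 0) = 0"
      by (rule sum.neutral) (auto simp: q'_def compl)
    then show ?thesis
      unfolding shared_resistance_quadratic arcs_away_endpoint(1)[OF uv]
      using arcs_away_endpoint(2)[OF uv] by simp
  qed
  also have "\<dots> = (\<Sum>c | (u, c) \<in> E. \<Sum>x\<in>S u c. \<Sum>y\<in>S u c. shared_resistance u x y * q' x * q' y)"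
    by (rule shared_resistance_block_diagonal[OF u])
  also have "\<dots> = (\<Sum>c | (u, c) \<in> E \<and> c \<noteq> v. \<Sum>x\<in>S u c. \<Sum>y\<in>S u c. shared_resistance u x y * q x * q y)"
  proof (rule sum.mono_neutral_cong_right)
    show "\<forall>c\<in>{c. (u, c) \<in> E} - {c. (u, c) \<in> E \<and> c \<noteq> v}.
        (\<Sum>x\<in>S u c. \<Sum>y\<in>S u c. shared_resistance u x y * q' x * q' y) = 0"
      by (auto simp: q'_def compl)
    fix c assume "c \<in> {c. (u, c) \<in> E \<and> c \<noteq> v}"
    then have "S u c \<subseteq> S v u"
      using branches_disjoint[OF uv, of c] branch_in_verts unfolding compl by blast
    then show "(\<Sum>x\<in>S u c. \<Sum>y\<in>S u c. shared_resistance u x y * q' x * q' y)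
        = (\<Sum>x\<in>S u c. \<Sum>y\<in>S u c. shared_resistance u x y * q x * q y)"
      by (intro sum.cong refl) (auto simp: q'_def)
  qed auto
  finally show ?thesis .
qed

end

section \<open>Block lower triangular matrices\<close>

definition block_pos :: "'a::linorder set \<Rightarrow> 'a \<Rightarrow> nat" where
  "block_pos X x = card {y \<in> X. y < x}"

definition scalar_index :: "nat \<Rightarrow> 'a::linorder set \<Rightarrow> 'a \<Rightarrow> nat \<Rightarrow> nat" where
  "scalar_index s X x i = block_pos X x * s + i"

lemma sorted_list_of_set_block_pos:
  assumes fin: "finite X" and x: "x \<in> X"
  shows "sorted_list_of_set X ! block_pos X x = x" "block_pos X x < card X"
proof -
  let ?l = "sorted_list_of_set X"
  have len: "length ?l = card X" and set: "set ?l = X" using fin by auto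
  obtain k where k: "k < card X" "?l ! k = x" using x set len by (metis in_set_conv_nth)
  have less: "?l ! i < ?l ! j \<longleftrightarrow> i < j" if "i < card X" "j < card X" for i j
    using that sorted_wrt_nth_less[OF strict_sorted_list_of_set[of X]] len
    by (metis linorder_neqE_nat order_less_asym order_less_irrefl)
  have "{y \<in> X. y < x} = (\<lambda>j. ?l ! j) ` {..<k}"
  proof (intro equalityI subsetI)
    fix y assume "y \<in> {y \<in> X. y < x}"
    then obtain j where "j < card X" "y = ?l ! j" "y < x" using set len
      by (metis (mono_tags, lifting) in_set_conv_nth mem_Collect_eq)
    then show "y \<in> (\<lambda>j. ?l ! j) ` {..<k}" using less k by auto
  next
    fix y assume "y \<in> (\<lambda>j. ?l ! j) ` {..<k}"
    then obtain j where "j < k" "y = ?l ! j" by auto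
    then show "y \<in> {y \<in> X. y < x}" using less[of j k] k set len nth_mem[of j ?l] by auto
  qed
  moreover have "inj_on (\<lambda>j. ?l ! j) {..<k}"
    using k len by (auto simp: inj_on_def nth_eq_iff_index_eq)
  ultimately have "block_pos X x = k" by (simp add: block_pos_def card_image)
  then show "?l ! block_pos X x = x" "block_pos X x < card X" using k by auto
qed

lemma block_pos_less_iff:
  assumes "finite X" "x \<in> X" "y \<in> X"
  shows "block_pos X x < block_pos X y \<longleftrightarrow> x < y"
proof -
  have less: "block_pos X x < block_pos X y" if "x < y" "x \<in> X" for x y
    unfolding block_pos_def by (rule psubset_card_mono) (use assms(1) that in auto)
  then show ?thesis using assms(2,3) by (metis linorder_less_linear order_less_asym order_less_irrefl)
qed

lemma block_pos_eq_iff: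
  assumes "finite X" "x \<in> X" "y \<in> X"
  shows "block_pos X x = block_pos X y \<longleftrightarrow> x = y"
  using sorted_list_of_set_block_pos(1)[OF assms(1)] assms(2,3) by metis

lemma scalar_index_div_mod [simp]:
  assumes "i < s"
  shows "scalar_index s X x i div s = block_pos X x" "scalar_index s X x i mod s = i"
  using assms by (simp_all add: scalar_index_def)

lemma scalar_index_less:
  assumes "finite X" "x \<in> X" "i < s"
  shows "scalar_index s X x i < card X * s"
proof -
  have "scalar_index s X x i < (block_pos X x + 1) * s" using assms(3) by (simp add: scalar_index_def)
  also have "\<dots> \<le> card X * s"
    using sorted_list_of_set_block_pos(2)[OF assms(1,2)] by (intro mult_le_mono1) simp
  finally show ?thesis .
qed

lemma scalar_index_eq_iff:
  assumes "finite X" "x \<in> X" "y \<in> X" "i < s" "j < s"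
  shows "scalar_index s X x i = scalar_index s X y j \<longleftrightarrow> x = y \<and> i = j"
  using assms scalar_index_div_mod block_pos_eq_iff by metis

lemma scalar_index_less_iff:
  assumes "finite X" "x \<in> X" "y \<in> X" "i < s" "j < s"
  shows "scalar_index s X x i < scalar_index s X y j \<longleftrightarrow> x < y \<or> x = y \<and> i < j"
proof -
  have less: "scalar_index s X x i < scalar_index s X y j" if "x < y" "x \<in> X" "y \<in> X" "i < s" for x y i j
  proof -
    have "Suc (block_pos X x) * s \<le> block_pos X y * s"
      using block_pos_less_iff[OF assms(1) that(2,3)] that(1) by (intro mult_le_mono1) simp
    then show ?thesis using that(4) by (simp add: scalar_index_def)
  qed
  consider "x < y" | "x = y" | "y < x" by fastforce
  then show ?thesis
  proof cases
    case 1 then show ?thesis using less assms by blast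
  next
    case 2 then show ?thesis by (simp add: scalar_index_def)
  next
    case 3 then show ?thesis using less[of y x j i] assms by auto
  qed
qed

lemma scalar_index_cases:
  assumes "finite X" "k < card X * s"
  obtains x i where "x \<in> X" "i < s" "k = scalar_index s X x i"
proof -
  have s: "0 < s" using assms by (cases s) auto
  let ?x = "sorted_list_of_set X ! (k div s)"
  have k: "k div s < card X" using assms s by (simp add: div_less_iff_less_mult)
  then have x: "?x \<in> X" using assms(1) by (metis length_sorted_list_of_set nth_mem set_sorted_list_of_set)
  have "sorted_list_of_set X ! block_pos X ?x = ?x" "block_pos X ?x < card X"
    using sorted_list_of_set_block_pos[OF assms(1) x] by auto
  then have "block_pos X ?x = k div s"
    using k nth_eq_iff_index_eq[OF distinct_sorted_list_of_set[of X]] by simp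
  then show ?thesis using that[of ?x "k mod s"] x s by (simp add: scalar_index_def)
qed

lemma sum_scalar_index:
  assumes "finite X"
  shows "(\<Sum>k<card X * s. f k) = (\<Sum>x\<in>X. \<Sum>i<s. f (scalar_index s X x i))"
proof -
  have "bij_betw (\<lambda>(x, i). scalar_index s X x i) (X \<times> {..<s}) {..<card X * s}"
  proof (rule bij_betwI')
    fix k assume "k \<in> {..<card X * s}"
    then obtain x i where "x \<in> X" "i < s" "k = scalar_index s X x i"
      using scalar_index_cases[OF assms] by blast
    then show "\<exists>a\<in>X \<times> {..<s}. k = (case a of (x, i) \<Rightarrow> scalar_index s X x i)" by auto
  qed (auto simp: scalar_index_eq_iff[OF assms] scalar_index_less[OF assms])
  then have "(\<Sum>a\<in>X \<times> {..<s}. f (case a of (x, i) \<Rightarrow> scalar_index s X x i)) = (\<Sum>k<card X * s. f k)"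
    by (rule sum.reindex_bij_betw)
  then show ?thesis by (simp add: sum.cartesian_product case_prod_unfold)
qed

text \<open>
  The blocks are \<open>s \<times> s\<close> and lower triangular, and \<open>g i\<close> collects their \<open>i\<close>-th diagonal entries into a matrix
  indexed by \<open>X\<close>. After sorting the scalar indices by their position in the block, \<open>A\<close> becomes a
  lower triangular arrangement of \<open>s\<close> matrices with \<open>g 0, \<dots>, g (s - 1)\<close> on the diagonal.
\<close>

definition block_lower_triangular ::
  "nat \<Rightarrow> 'a::linorder set \<Rightarrow> 'b::zero mat \<Rightarrow> (nat \<Rightarrow> 'a \<Rightarrow> 'a \<Rightarrow> 'b) \<Rightarrow> bool" where
  "block_lower_triangular s X A g \<longleftrightarrow> A \<in> carrier_mat (card X * s) (card X * s) \<and>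
     (\<forall>x\<in>X. \<forall>y\<in>X. \<forall>i<s. \<forall>j<s.
        (i < j \<longrightarrow> A $$ (scalar_index s X x i, scalar_index s X y j) = 0) \<and>
        (i = j \<longrightarrow> A $$ (scalar_index s X x i, scalar_index s X y j) = g i x y))"

lemma block_lower_triangularI:
  assumes "A \<in> carrier_mat (card X * s) (card X * s)"
    and "\<And>x y i j. x \<in> X \<Longrightarrow> y \<in> X \<Longrightarrow> i < j \<Longrightarrow> j < s \<Longrightarrow>
      A $$ (scalar_index s X x i, scalar_index s X y j) = 0"
    and "\<And>x y i. x \<in> X \<Longrightarrow> y \<in> X \<Longrightarrow> i < s \<Longrightarrow>
      A $$ (scalar_index s X x i, scalar_index s X y i) = g i x y"
  shows "block_lower_triangular s X A g"
  using assms unfolding block_lower_triangular_def by auto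

lemma block_lower_triangularD:
  assumes "block_lower_triangular s X A g"
  shows "A \<in> carrier_mat (card X * s) (card X * s)"
    and "x \<in> X \<Longrightarrow> y \<in> X \<Longrightarrow> i < j \<Longrightarrow> j < s \<Longrightarrow>
      A $$ (scalar_index s X x i, scalar_index s X y j) = 0"
    and "x \<in> X \<Longrightarrow> y \<in> X \<Longrightarrow> i < s \<Longrightarrow>
      A $$ (scalar_index s X x i, scalar_index s X y i) = g i x y"
  using assms unfolding block_lower_triangular_def by auto

lemma block_lower_triangular_cong:
  assumes "block_lower_triangular s X A g"
    and "\<And>x y i. x \<in> X \<Longrightarrow> y \<in> X \<Longrightarrow> i < s \<Longrightarrow> g i x y = h i x y"
  shows "block_lower_triangular s X A h"
  using assms unfolding block_lower_triangular_def by auto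

lemma block_lower_triangular_block_mat:
  assumes fin: "finite X"
    and "\<And>x y i j. x \<in> X \<Longrightarrow> y \<in> X \<Longrightarrow> i < j \<Longrightarrow> j < s \<Longrightarrow> f x y $$ (i, j) = 0"
  shows "block_lower_triangular s X (block_mat s X f) (\<lambda>i x y. f x y $$ (i, i))"
proof -
  have "block_mat s X f $$ (scalar_index s X x i, scalar_index s X y j) = f x y $$ (i, j)"
    if "x \<in> X" "y \<in> X" "i < s" "j < s" for x y i j
    using that scalar_index_less[OF fin] sorted_list_of_set_block_pos(1)[OF fin]
    by (simp add: block_mat_def)
  then show ?thesis using assms(2)
    by (intro block_lower_triangularI) (auto simp: block_mat_def)
qed

lemma block_lower_triangular_map:
  assumes fin: "finite X" and A: "block_lower_triangular s X A g" and "h 0 = 0"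
  shows "block_lower_triangular s X (map_mat h A) (\<lambda>i x y. h (g i x y))"
  using block_lower_triangularD[OF A] scalar_index_less[OF fin] assms(3)
  by (intro block_lower_triangularI) auto

lemma block_lower_triangular_smult:
  assumes fin: "finite X" and A: "block_lower_triangular s X (A :: 'b :: semiring_0 mat) g"
  shows "block_lower_triangular s X (c \<cdot>\<^sub>m A) (\<lambda>i x y. c * g i x y)"
  using block_lower_triangularD[OF A] scalar_index_less[OF fin]
  by (intro block_lower_triangularI) auto

lemma block_lower_triangular_mult_vec:
  fixes A :: "'b :: comm_semiring_0 mat"
  assumes fin: "finite X" and A: "block_lower_triangular s X A g"
    and v: "v \<in> carrier_vec (card X * s)"
    and i: "i < s" and v0: "\<And>y j. y \<in> X \<Longrightarrow> j < i \<Longrightarrow> v $ scalar_index s X y j = 0"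
    and x: "x \<in> X"
  shows "(A *\<^sub>v v) $ scalar_index s X x i = (\<Sum>y\<in>X. g i x y * v $ scalar_index s X y i)"
proof -
  note A' = block_lower_triangularD[OF A]
  have "(A *\<^sub>v v) $ scalar_index s X x i
      = (\<Sum>k<card X * s. A $$ (scalar_index s X x i, k) * v $ k)"
    using A'(1) v scalar_index_less[OF fin x i]
    by (auto simp: scalar_prod_def lessThan_atLeast0 intro!: sum.cong)
  also have "\<dots> = (\<Sum>y\<in>X. \<Sum>j<s. A $$ (scalar_index s X x i, scalar_index s X y j)
      * v $ scalar_index s X y j)"
    by (rule sum_scalar_index[OF fin])
  also have "\<dots> = (\<Sum>y\<in>X. \<Sum>j<s. if j = i then g i x y * v $ scalar_index s X y i else 0)"
  proof (intro sum.cong refl)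
    fix y j assume y: "y \<in> X" and j: "j \<in> {..<s}"
    show "A $$ (scalar_index s X x i, scalar_index s X y j) * v $ scalar_index s X y j
        = (if j = i then g i x y * v $ scalar_index s X y i else 0)"
      using A'(2)[OF x y, of i j] A'(3)[OF x y, of i] v0[OF y, of j] j i
      by (cases j i rule: linorder_cases) auto
  qed
  also have "\<dots> = (\<Sum>y\<in>X. g i x y * v $ scalar_index s X y i)" using i by simp
  finally show ?thesis .
qed

text \<open>
  Look at the first position \<open>i\<close> inside the blocks at which the eigenvector does not vanish. The
  earlier positions contribute nothing, and the later ones do not act on it.
\<close>

lemma block_lower_triangular_eigenvector:
  fixes A :: "'b :: comm_ring_1 mat"
  assumes fin: "finite X" and A: "block_lower_triangular s X A g"
    and v: "v \<in> carrier_vec (card X * s)" "v \<noteq> 0\<^sub>v (card X * s)" "A *\<^sub>v v = k \<cdot>\<^sub>v v"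
  obtains i u where "i < s" "\<exists>x\<in>X. u x \<noteq> 0" "\<And>x. x \<in> X \<Longrightarrow> (\<Sum>y\<in>X. g i x y * u y) = k * u x"
proof -
  let ?P = "\<lambda>i. i < s \<and> (\<exists>x\<in>X. v $ scalar_index s X x i \<noteq> 0)"
  define i where "i = (LEAST i. ?P i)"
  obtain m where "m < card X * s" "v $ m \<noteq> 0" using v(1,2) by (metis carrier_vecD eq_vecI index_zero_vec)
  then have "\<exists>i. ?P i" using scalar_index_cases[OF fin] by metis
  then have i: "?P i" unfolding i_def by (rule LeastI_ex)
  have small: "v $ scalar_index s X y j = 0" if "y \<in> X" "j < i" for y j
    using not_less_Least[of j ?P] that i unfolding i_def by auto
  show ?thesis
  proof (rule that[of i "\<lambda>x. v $ scalar_index s X x i"])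
    fix x assume x: "x \<in> X"
    have "(\<Sum>y\<in>X. g i x y * v $ scalar_index s X y i) = (A *\<^sub>v v) $ scalar_index s X x i"
      using block_lower_triangular_mult_vec[OF fin A v(1) _ small x] i by simp
    then show "(\<Sum>y\<in>X. g i x y * v $ scalar_index s X y i) = k * v $ scalar_index s X x i"
      using v scalar_index_less[OF fin x] i by simp
  qed (use i in auto)
qed

lemma block_lower_triangular_mult:
  fixes A :: "'b :: comm_semiring_0 mat"
  assumes fin: "finite X" and A: "block_lower_triangular s X A g" and B: "block_lower_triangular s X B h"
  shows "block_lower_triangular s X (A * B) (\<lambda>i x z. \<Sum>y\<in>X. g i x y * h i y z)"
proof -
  note A' = block_lower_triangularD[OF A] and B' = block_lower_triangularD[OF B]
  have col: "(A * B) $$ (scalar_index s X x i, scalar_index s X z k)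
      = (A *\<^sub>v col B (scalar_index s X z k)) $ scalar_index s X x i"
    if "x \<in> X" "i < s" "z \<in> X" "k < s" for x i z k
    using A'(1) B'(1) scalar_index_less[OF fin] that by simp
  have colB: "col B (scalar_index s X z k) $ scalar_index s X y j
      = B $$ (scalar_index s X y j, scalar_index s X z k)"
    if "y \<in> X" "j < s" "z \<in> X" "k < s" for y j z k
    using B'(1) scalar_index_less[OF fin] that by simp
  have carr: "col B m \<in> carrier_vec (card X * s)" for m using B'(1) by (simp add: carrier_vecI)
  have entry: "(A * B) $$ (scalar_index s X x i, scalar_index s X z k)
      = (\<Sum>y\<in>X. g i x y * B $$ (scalar_index s X y i, scalar_index s X z k))"
    if "x \<in> X" "i \<le> k" "z \<in> X" "k < s" for x i z k
    unfolding col[OF that(1) order_le_less_trans[OF that(2,4)] that(3,4)]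
    using that B'(2) by (subst block_lower_triangular_mult_vec[OF fin A carr]) (auto simp: colB)
  show ?thesis
    by (intro block_lower_triangularI) (use A'(1) B' in \<open>auto simp: entry\<close>)
qed

text \<open>
  A kernel vector would give one for some \<open>f i\<close> by the eigenvector argument, so \<open>A\<close> is invertible. A column
  of the inverse solves a linear system whose first nonzero part, by forward substitution, is a
  column of \<open>g k\<close>.
\<close>

lemma block_lower_triangular_inverse:
  fixes A :: "'b :: field mat"
  assumes fin: "finite X" and A: "block_lower_triangular s X A f"
    and inv: "\<And>i x z. i < s \<Longrightarrow> x \<in> X \<Longrightarrow> z \<in> X \<Longrightarrow>
      (\<Sum>y\<in>X. g i x y * f i y z) = (if x = z then 1 else 0)"
  shows "block_lower_triangular s X (inverse_mat A) g"
proof -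
  let ?n = "card X * s"
  have A_carr: "A \<in> carrier_mat ?n ?n" by (rule block_lower_triangularD(1)[OF A])
  have solve: "u x = (\<Sum>y\<in>X. g i x y * b y)"
    if i: "i < s" and x: "x \<in> X" and eq: "\<And>y. y \<in> X \<Longrightarrow> (\<Sum>z\<in>X. f i y z * u z) = b y" for i x u b
  proof -
    have "(\<Sum>y\<in>X. g i x y * b y) = (\<Sum>y\<in>X. \<Sum>z\<in>X. g i x y * f i y z * u z)"
      by (simp add: eq[symmetric] sum_distrib_left mult.assoc)
    also have "\<dots> = (\<Sum>z\<in>X. (\<Sum>y\<in>X. g i x y * f i y z) * u z)"
      by (subst sum.swap) (simp add: sum_distrib_right)
    also have "\<dots> = (\<Sum>z\<in>X. if x = z then u z else 0)"
      by (rule sum.cong) (auto simp: inv i x)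
    finally show ?thesis using fin x by simp
  qed
  have "det A \<noteq> 0"
  proof
    assume "det A = 0"
    then obtain v where v: "v \<in> carrier_vec ?n" "v \<noteq> 0\<^sub>v ?n" "A *\<^sub>v v = 0\<^sub>v ?n"
      using det_0_iff_vec_prod_zero_field[OF A_carr] by blast
    then have "A *\<^sub>v v = 0 \<cdot>\<^sub>v v" by (intro eq_vecI) auto
    from block_lower_triangular_eigenvector[OF fin A v(1,2) this]
    obtain i u where u: "i < s" "\<exists>x\<in>X. u x \<noteq> 0" "\<And>x. x \<in> X \<Longrightarrow> (\<Sum>y\<in>X. f i x y * u y) = 0" by auto
    then show False using solve[OF u(1) _ u(3)] by auto
  qed
  then obtain B where "mat_inverse A = Some B"
    using mat_inverse(1)[OF A_carr] det_non_zero_imp_unit[OF A_carr] by (metis option.exhaust)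
  then have AB: "A * B = 1\<^sub>m ?n" and B: "B \<in> carrier_mat ?n ?n" and inv_eq: "inverse_mat A = B"
    using mat_inverse(2)[OF A_carr] by (auto simp: inverse_mat_def)
  have column: "(\<forall>x\<in>X. \<forall>i<k. B $$ (scalar_index s X x i, scalar_index s X z k) = 0) \<and>
      (\<forall>x\<in>X. B $$ (scalar_index s X x k, scalar_index s X z k) = g k x z)"
    if z: "z \<in> X" and k: "k < s" for z k
  proof -
    let ?b = "col B (scalar_index s X z k)"
    have b: "?b \<in> carrier_vec ?n" using B by (simp add: carrier_vecI)
    have b_entry: "?b $ scalar_index s X x i = B $$ (scalar_index s X x i, scalar_index s X z k)"
      if "x \<in> X" "i < s" for x i
      using that B scalar_index_less[OF fin] z k by simp
    have Ab: "A *\<^sub>v ?b = unit_vec ?n (scalar_index s X z k)"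
      using AB A_carr B scalar_index_less[OF fin z k] by (metis carrier_matD(2) col_mult2 col_one)
    have row: "?b $ scalar_index s X x i
        = (\<Sum>y\<in>X. g i x y * (if y = z \<and> i = k then 1 else 0))"
      if x: "x \<in> X" and i: "i < s" and small: "\<And>y j. y \<in> X \<Longrightarrow> j < i \<Longrightarrow> ?b $ scalar_index s X y j = 0"
      for x i
    proof (rule solve[OF i x])
      fix y assume y: "y \<in> X"
      have "(\<Sum>w\<in>X. f i y w * ?b $ scalar_index s X w i) = (A *\<^sub>v ?b) $ scalar_index s X y i"
        using block_lower_triangular_mult_vec[OF fin A b i small y] by simp
      then show "(\<Sum>w\<in>X. f i y w * ?b $ scalar_index s X w i) = (if y = z \<and> i = k then 1 else 0)"
        using Ab scalar_index_less[OF fin y i] scalar_index_less[OF fin z k]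
          scalar_index_eq_iff[OF fin y z i k] by simp
    qed
    have zero: "?b $ scalar_index s X x i = 0" if "x \<in> X" "i < k" for x i
      using that
    proof (induction i arbitrary: x rule: less_induct)
      case (less i)
      then show ?case using row[of x i] k by simp
    qed
    have "?b $ scalar_index s X x k = g k x z" if "x \<in> X" for x
      using row[OF that k zero] fin z by (simp add: if_distrib[of "(*) _"] cong: if_cong)
    then show ?thesis using zero b_entry k by auto
  qed
  then show ?thesis unfolding inv_eq using B by (intro block_lower_triangularI) auto
qed

text \<open>
  A submatrix picks its indices in increasing order. The scalar index of \<open>(x, i)\<close> in the selected
  blocks is therefore the number of selected indices below that of \<open>(x, i)\<close> in \<open>X\<close>.
\<close>

lemma block_lower_triangular_principal_submat:
  assumes fin: "finite X" and U: "U \<subseteq> X" and A: "block_lower_triangular s X A g"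
  shows "block_lower_triangular s U (principal_block_submat s X A U) g"
proof -
  let ?I = "block_indices s X U"
  have finU: "finite U" using fin U by (rule rev_finite_subset)
  note A' = block_lower_triangularD[OF A]
  have I: "?I = (\<lambda>(x, i). scalar_index s X x i) ` (U \<times> {..<s})"
  proof (intro equalityI subsetI)
    fix k assume k: "k \<in> ?I"
    then obtain x i where xi: "x \<in> X" "i < s" "k = scalar_index s X x i"
      using scalar_index_cases[OF fin] unfolding block_indices_def by blast
    then have "x \<in> U" using k sorted_list_of_set_block_pos(1)[OF fin] by (simp add: block_indices_def)
    then show "k \<in> (\<lambda>(x, i). scalar_index s X x i) ` (U \<times> {..<s})" using xi by auto
  next
    fix k assume "k \<in> (\<lambda>(x, i). scalar_index s X x i) ` (U \<times> {..<s})"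
    then obtain x i where "x \<in> U" "i < s" "k = scalar_index s X x i" by auto
    then show "k \<in> ?I" using U scalar_index_less[OF fin] sorted_list_of_set_block_pos(1)[OF fin]
      by (auto simp: block_indices_def)
  qed
  have inj: "inj_on (\<lambda>(x, i). scalar_index s X x i) (U \<times> {..<s})"
    by (rule inj_onI) (auto simp: scalar_index_eq_iff[OF fin] subsetD[OF U])
  have "?I \<subseteq> {..<card X * s}" unfolding block_indices_def by auto
  then have "{i. i < dim_row A \<and> i \<in> ?I} = ?I" "{i. i < dim_col A \<and> i \<in> ?I} = ?I" using A'(1) by auto
  moreover have "card ?I = card U * s" unfolding I using inj by (simp add: card_image card_cartesian_product)
  ultimately have dim: "principal_block_submat s X A U \<in> carrier_mat (card U * s) (card U * s)"
    unfolding principal_block_submat_def by (intro carrier_matI) (simp_all only: dim_submatrix)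
  have count: "card {k \<in> ?I. k < scalar_index s X x i} = scalar_index s U x i"
    if x: "x \<in> U" and i: "i < s" for x i
  proof -
    have "{k \<in> ?I. k < scalar_index s X x i}
        = (\<lambda>(x, i). scalar_index s X x i) ` ({y \<in> U. y < x} \<times> {..<s} \<union> {x} \<times> {..<i})"
    proof -
      have "{a \<in> U \<times> {..<s}. (case a of (y, j) \<Rightarrow> scalar_index s X y j) < scalar_index s X x i}
          = {y \<in> U. y < x} \<times> {..<s} \<union> {x} \<times> {..<i}"
        using x i by (auto simp: scalar_index_less_iff[OF fin] subsetD[OF U])
      then show ?thesis unfolding I by blast
    qed
    moreover have "inj_on (\<lambda>(x, i). scalar_index s X x i) ({y \<in> U. y < x} \<times> {..<s} \<union> {x} \<times> {..<i})"
      by (rule inj_on_subset[OF inj]) (use x i in auto)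
    ultimately have "card {k \<in> ?I. k < scalar_index s X x i}
        = card ({y \<in> U. y < x} \<times> {..<s} \<union> {x} \<times> {..<i})" by (simp add: card_image)
    also have "\<dots> = card ({y \<in> U. y < x} \<times> {..<s}) + card ({x} \<times> {..<i})"
      using finU by (intro card_Un_disjoint) auto
    finally show ?thesis by (simp add: scalar_index_def block_pos_def card_cartesian_product)
  qed
  have entry: "principal_block_submat s X A U $$ (scalar_index s U x i, scalar_index s U y j)
      = A $$ (scalar_index s X x i, scalar_index s X y j)"
    if "x \<in> U" "y \<in> U" "i < s" "j < s" for x y i j
    unfolding principal_block_submat_def count[OF that(1,3), symmetric] count[OF that(2,4), symmetric]
    by (rule submatrix_index_card)
       (use that U A'(1) scalar_index_less[OF fin] in \<open>auto simp: I\<close>)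
  show ?thesis
    using dim A'(2,3) U by (intro block_lower_triangularI) (auto simp: entry subset_iff)
qed

lemma block_lower_triangular_minus_kronecker:
  fixes A :: "real mat"
  assumes fin: "finite X" and A: "block_lower_triangular s X A g"
    and K: "K \<in> carrier_mat s s" "\<And>i j. i < j \<Longrightarrow> j < s \<Longrightarrow> K $$ (i, j) = 0"
  shows "block_lower_triangular s X (A - t \<cdot>\<^sub>m kronecker (all_ones (card X)) K)
    (\<lambda>i x y. g i x y - t * K $$ (i, i))"
proof -
  let ?J = "kronecker (all_ones (card X)) K"
  have dim: "?J \<in> carrier_mat (card X * s) (card X * s)"
    using K by (simp add: kronecker_def all_ones_def)
  have "?J $$ (scalar_index s X x i, scalar_index s X y j) = K $$ (i, j)"
    if "x \<in> X" "y \<in> X" "i < s" "j < s" for x y i j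
    using that K scalar_index_less[OF fin] sorted_list_of_set_block_pos(2)[OF fin]
    by (simp add: kronecker_def all_ones_def)
  then show ?thesis
    using block_lower_triangularD[OF A] dim scalar_index_less[OF fin] K
    by (intro block_lower_triangularI) auto
qed

text \<open>
  This is the inverse of a block matrix with a single block, indexed by an arbitrary one-element set.
\<close>

lemma lower_triangular_inverse:
  fixes K :: "'b :: field mat"
  assumes K: "K \<in> carrier_mat s s" "\<And>i j. i < j \<Longrightarrow> j < s \<Longrightarrow> K $$ (i, j) = 0"
    and diag: "\<And>i. i < s \<Longrightarrow> K $$ (i, i) \<noteq> 0"
  shows "inverse_mat K \<in> carrier_mat s s"
    and "i < j \<Longrightarrow> j < s \<Longrightarrow> inverse_mat K $$ (i, j) = 0"
    and "i < s \<Longrightarrow> inverse_mat K $$ (i, i) = 1 / K $$ (i, i)"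
proof -
  have index: "scalar_index s {0 :: nat} 0 i = i" for i by (simp add: scalar_index_def block_pos_def)
  have "block_lower_triangular s {0 :: nat} K (\<lambda>i x y. K $$ (i, i))"
    by (intro block_lower_triangularI) (use K in \<open>auto simp: index\<close>)
  then have "block_lower_triangular s {0 :: nat} (inverse_mat K) (\<lambda>i x y. 1 / K $$ (i, i))"
    by (rule block_lower_triangular_inverse[rotated]) (use diag in auto)
  note inv = block_lower_triangularD(1)[OF this] block_lower_triangularD(2,3)[OF this, of 0 0, unfolded index]
  show "inverse_mat K \<in> carrier_mat s s" using inv(1) by simp
  show "i < j \<Longrightarrow> j < s \<Longrightarrow> inverse_mat K $$ (i, j) = 0" using inv(2) by simp
  show "i < s \<Longrightarrow> inverse_mat K $$ (i, i) = 1 / K $$ (i, i)" using inv(3) by simp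
qed
section \<open>Spectral radius and quadratic forms\<close>

lemma pow_mat_add:
  fixes A :: "'b :: semiring_1 mat"
  assumes "A \<in> carrier_mat n n"
  shows "A ^\<^sub>m (k + l) = A ^\<^sub>m k * A ^\<^sub>m l"
proof (induction l)
  case 0
  then show ?case using assms pow_carrier_mat[OF assms, of k] by simp
next
  case (Suc l)
  then show ?case
    using assms assoc_mult_mat[OF pow_carrier_mat[OF assms] pow_carrier_mat[OF assms] assms] by simp
qed

lemma spectral_radius_smult_less:
  fixes A :: "complex mat"
  assumes A: "A \<in> carrier_mat n n" and n: "0 < n" and c: "spectral_radius A < c"
  shows "spectral_radius (complex_of_real (1 / c) \<cdot>\<^sub>m A) < 1"
proof -
  let ?C = "complex_of_real (1 / c) \<cdot>\<^sub>m A"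
  have C: "?C \<in> carrier_mat n n" using A by simp
  obtain \<zeta> v where "spectral_radius ?C = norm \<zeta>" and v: "eigenvector ?C v \<zeta>"
    using spectral_radius_mem_max(1)[OF C n] by (auto simp: spectrum_def eigenvalue_def)
  have "0 \<le> spectral_radius A" using spectral_radius_mem_max(1)[OF A n] by auto
  then have c0: "0 < c" using c by simp
  have v': "v \<in> carrier_vec n" "v \<noteq> 0\<^sub>v n" "?C *\<^sub>v v = \<zeta> \<cdot>\<^sub>v v"
    using v A by (auto simp: eigenvector_def)
  have "A *\<^sub>v v = complex_of_real c \<cdot>\<^sub>v (?C *\<^sub>v v)"
    using c0 A v'(1) by (intro eq_vecI) auto
  also have "\<dots> = (complex_of_real c * \<zeta>) \<cdot>\<^sub>v v" using v' by (simp add: smult_smult_assoc)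
  finally have "eigenvalue A (complex_of_real c * \<zeta>)"
    using v' A by (auto simp: eigenvalue_def eigenvector_def)
  then have "norm (complex_of_real c * \<zeta>) \<le> spectral_radius A"
    using spectral_radius_mem_max(2)[OF A n] by (auto simp: spectrum_def)
  then have "c * norm \<zeta> \<le> spectral_radius A" using c0 by (simp add: norm_mult)
  then have "c * norm \<zeta> < c * 1" using c by linarith
  then show ?thesis using c0 \<open>spectral_radius ?C = norm \<zeta>\<close> by simp
qed

definition quad :: "'a set \<Rightarrow> ('a \<Rightarrow> 'a \<Rightarrow> real) \<Rightarrow> ('a \<Rightarrow> real) \<Rightarrow> real" where
  "quad X g q = (\<Sum>x\<in>X. \<Sum>y\<in>X. g x y * q x * q y)"

lemma abs_quad_le_entries:
  assumes "\<And>x y. x \<in> X \<Longrightarrow> y \<in> X \<Longrightarrow> \<bar>g x y\<bar> \<le> b"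
  shows "\<bar>quad X g q\<bar> \<le> b * (\<Sum>x\<in>X. \<bar>q x\<bar>)\<^sup>2"
proof -
  have "\<bar>quad X g q\<bar> \<le> (\<Sum>x\<in>X. \<Sum>y\<in>X. \<bar>g x y * q x * q y\<bar>)"
    unfolding quad_def by (intro order_trans[OF sum_abs] sum_mono sum_abs)
  also have "\<dots> \<le> (\<Sum>x\<in>X. \<Sum>y\<in>X. b * (\<bar>q x\<bar> * \<bar>q y\<bar>))"
    using assms by (intro sum_mono) (simp add: abs_mult mult.assoc mult_right_mono)
  also have "\<dots> = b * (\<Sum>x\<in>X. \<bar>q x\<bar>)\<^sup>2"
    by (simp add: power2_eq_square sum_product sum_distrib_left[symmetric])
  finally show ?thesis .
qed

text \<open>
  By Cauchy and Schwarz, since the quadratic form of \<open>g\<^sup>2\<close> is the squared norm of \<open>g q\<close>.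
\<close>

lemma quad_square:
  assumes sym: "\<And>x y. x \<in> X \<Longrightarrow> y \<in> X \<Longrightarrow> g x y = g y x"
  shows "(quad X g q)\<^sup>2 \<le> quad X (\<lambda>x z. \<Sum>y\<in>X. g x y * g y z) q * (\<Sum>x\<in>X. (q x)\<^sup>2)"
proof -
  define G where "G y = (\<Sum>x\<in>X. g y x * q x)" for y
  have "quad X g q = (\<Sum>x\<in>X. G x * q x)"
    by (simp add: quad_def G_def sum_distrib_right sum_distrib_left mult_ac)
  then have "(quad X g q)\<^sup>2 \<le> (\<Sum>x\<in>X. (G x)\<^sup>2) * (\<Sum>x\<in>X. (q x)\<^sup>2)"
    using Cauchy_Schwarz_ineq_sum[of G q X] by simp
  also have "(\<Sum>y\<in>X. (G y)\<^sup>2) = (\<Sum>y\<in>X. \<Sum>x\<in>X. \<Sum>z\<in>X. g x y * g y z * q x * q z)"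
    unfolding G_def power2_eq_square sum_product by (intro sum.cong refl) (simp add: sym mult_ac)
  also have "\<dots> = (\<Sum>x\<in>X. \<Sum>z\<in>X. \<Sum>y\<in>X. g x y * g y z * q x * q z)"
    by (subst sum.swap) (intro sum.cong refl sum.swap)
  also have "\<dots> = quad X (\<lambda>x z. \<Sum>y\<in>X. g x y * g y z) q"
    by (simp add: quad_def sum_distrib_right)
  finally show ?thesis .
qed

text \<open>
  If the form exceeded the bound, some \<open>c\<close> larger than the spectral radius would still satisfy
  \<open>c |q|\<^sup>2 < |q\<^sup>T (g i) q|\<close>. The powers of \<open>A / c\<close> are bounded because its spectral radius is below 1. Yet the
  normalised form of \<open>(g i / c)\<^sup>k\<close>, which is the \<open>i\<close>-th diagonal part of the \<open>k\<close>-th power, is at least squared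
  whenever \<open>k\<close> doubles, and it starts above 1.
\<close>

lemma spectral_radius_bounds_quad:
  fixes A :: "real mat"
  assumes fin: "finite X" and ne: "X \<noteq> {}" and A: "block_lower_triangular s X A g"
    and i: "i < s" and sym: "\<And>x y. x \<in> X \<Longrightarrow> y \<in> X \<Longrightarrow> g i x y = g i y x"
  shows "\<bar>quad X (g i) q\<bar> \<le> real_spectral_radius A * (\<Sum>x\<in>X. (q x)\<^sup>2)"
proof (rule ccontr)
  let ?N = "\<Sum>x\<in>X. (q x)\<^sup>2" and ?n = "card X * s"
  let ?B = "map_mat complex_of_real A"
  let ?\<rho> = "spectral_radius ?B"
  assume "\<not> ?thesis"
  then have large: "?\<rho> * ?N < \<bar>quad X (g i) q\<bar>" by (simp add: real_spectral_radius_def)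
  have n: "0 < ?n" using fin ne i by (simp add: card_gt_0_iff)
  have B: "block_lower_triangular s X ?B (\<lambda>i x y. complex_of_real (g i x y))"
    by (rule block_lower_triangular_map[OF fin A]) simp
  then have B': "?B \<in> carrier_mat ?n ?n" by (rule block_lower_triangularD)
  have "0 \<le> ?\<rho>" using spectral_radius_mem_max(1)[OF B' n] by auto
  have N: "0 < ?N"
  proof (rule ccontr)
    assume "\<not> 0 < ?N"
    then have "?N = 0" using sum_nonneg[of X "\<lambda>x. (q x)\<^sup>2"] by fastforce
    then have "q x = 0" if "x \<in> X" for x using that fin by (simp add: sum_nonneg_eq_0_iff)
    then show False using large \<open>?N = 0\<close> by (simp add: quad_def)
  qed
  obtain c where c: "?\<rho> < c" "c < \<bar>quad X (g i) q\<bar> / ?N"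
    using dense[of ?\<rho> "\<bar>quad X (g i) q\<bar> / ?N"] large N by (auto simp: pos_less_divide_eq)
  have c0: "0 < c" using c \<open>0 \<le> ?\<rho>\<close> by simp
  define C where "C = complex_of_real (1 / c) \<cdot>\<^sub>m ?B"
  have C: "C \<in> carrier_mat ?n ?n" using B' by (simp add: C_def)
  obtain b where b: "\<And>k. norm_bound (C ^\<^sub>m k) b"
    using spectral_radius_jnf_norm_bound_less_1_upper_triangular[OF C]
      spectral_radius_smult_less[OF B' n c(1)] unfolding C_def by blast
  \<comment> \<open>the diagonal parts of the powers \<open>C ^\<^sub>m 2 ^ j\<close>, by repeated squaring\<close>
  define h where "h = rec_nat (\<lambda>i x y. g i x y / c) (\<lambda>_ h i x z. \<Sum>y\<in>X. h i x y * h i y z)"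
  have h0: "h 0 = (\<lambda>i x y. g i x y / c)" and hSuc: "h (Suc j) = (\<lambda>i x z. \<Sum>y\<in>X. h j i x y * h j i y z)" for j
    by (simp_all add: h_def)
  have C_blocks: "block_lower_triangular s X (C ^\<^sub>m (2 ^ j)) (\<lambda>i x y. complex_of_real (h j i x y))" for j
  proof (induction j)
    case 0
    have "block_lower_triangular s X C (\<lambda>i x y. complex_of_real (1 / c) * complex_of_real (g i x y))"
      unfolding C_def by (rule block_lower_triangular_smult[OF fin B])
    then show ?case using C by (simp add: h0)
  next
    case (Suc j)
    have "C ^\<^sub>m (2 ^ Suc j) = C ^\<^sub>m (2 ^ j) * C ^\<^sub>m (2 ^ j)"
      using pow_mat_add[OF C, of "2 ^ j" "2 ^ j"] by (simp add: mult_2)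
    then show ?case
      using block_lower_triangular_mult[OF fin Suc Suc] by (simp add: hSuc)
  qed
  have h_bound: "\<bar>h j i x y\<bar> \<le> b" if "x \<in> X" "y \<in> X" for j x y
  proof -
    have "norm ((C ^\<^sub>m (2 ^ j)) $$ (scalar_index s X x i, scalar_index s X y i)) \<le> b"
      using b[of "2 ^ j"] C scalar_index_less[OF fin] that i by (simp add: norm_bound_def)
    then show ?thesis
      using block_lower_triangularD(3)[OF C_blocks[of j] that i] by simp
  qed
  have h_sym: "h j i x y = h j i y x" if "x \<in> X" "y \<in> X" for j x y
    using that
  proof (induction j arbitrary: x y)
    case (Suc j)
    then show ?case unfolding hSuc by (intro sum.cong refl) (simp add: mult.commute)
  qed (simp add: h0 sym)
  define t where "t j = \<bar>quad X (h j i) q\<bar> / ?N" for j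
  have t_step: "(t j)\<^sup>2 \<le> t (Suc j)" for j
  proof -
    have "(quad X (h j i) q)\<^sup>2 \<le> \<bar>quad X (h (Suc j) i) q\<bar> * ?N"
      using quad_square[of X "h j i" q, OF h_sym] N mult_right_mono[OF abs_ge_self, of ?N]
      by (fastforce simp: hSuc intro: order_trans)
    then have "(quad X (h j i) q)\<^sup>2 / ?N\<^sup>2 \<le> \<bar>quad X (h (Suc j) i) q\<bar> * ?N / ?N\<^sup>2"
      by (rule divide_right_mono) simp
    then show ?thesis using N by (simp add: t_def power_divide power2_eq_square)
  qed
  have "quad X (h 0 i) q = quad X (g i) q / c" by (simp add: quad_def h0 sum_divide_distrib)
  then have "quad X (g i) q = c * quad X (h 0 i) q" using c0 by simp
  then have "c < c * t 0" using c(2) c0 by (simp add: t_def abs_mult)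
  then have t0: "1 < t 0" using c0 by simp
  have t_growth: "t 0 ^ (2 ^ j) \<le> t j" for j
  proof (induction j)
    case (Suc j)
    have "t 0 ^ (2 ^ Suc j) = (t 0 ^ (2 ^ j))\<^sup>2" by (simp add: power_mult[symmetric] mult.commute)
    also have "\<dots> \<le> (t j)\<^sup>2" using Suc t0 by (intro power_mono) auto
    finally show ?case using t_step[of j] by simp
  qed simp
  let ?K = "b * (\<Sum>x\<in>X. \<bar>q x\<bar>)\<^sup>2 / ?N"
  obtain j where j: "?K < t 0 ^ j" using real_arch_pow[OF t0] by blast
  have "t 0 ^ j \<le> t 0 ^ (2 ^ j)" using t0 by (intro power_increasing) auto
  also have "\<dots> \<le> t j" by (rule t_growth)
  also have "\<dots> \<le> ?K"
    unfolding t_def using abs_quad_le_entries[OF h_bound] N by (intro divide_right_mono) auto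
  finally show False using j by simp
qed

text \<open>
  The functions \<open>q1\<close> and \<open>q2\<close> are the real and the imaginary part of a complex eigenvector of the symmetric
  matrix \<open>g i\<close>. In particular \<open>\<zeta>\<close> is real.
\<close>

lemma complex_eigenvalue_block_lower_triangular:
  fixes A :: "real mat"
  assumes fin: "finite X" and A: "block_lower_triangular s X A g"
    and sym: "\<And>i x y. i < s \<Longrightarrow> x \<in> X \<Longrightarrow> y \<in> X \<Longrightarrow> g i x y = g i y x"
    and ev: "eigenvalue (map_mat complex_of_real A) \<zeta>"
  obtains i q1 q2 where "i < s" "0 < (\<Sum>x\<in>X. (q1 x)\<^sup>2) + (\<Sum>x\<in>X. (q2 x)\<^sup>2)"
    "\<zeta> * complex_of_real ((\<Sum>x\<in>X. (q1 x)\<^sup>2) + (\<Sum>x\<in>X. (q2 x)\<^sup>2))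
      = complex_of_real (quad X (g i) q1 + quad X (g i) q2)"
proof -
  let ?B = "map_mat complex_of_real A" and ?n = "card X * s"
  have B: "block_lower_triangular s X ?B (\<lambda>i x y. complex_of_real (g i x y))"
    by (rule block_lower_triangular_map[OF fin A]) simp
  obtain v where v: "v \<in> carrier_vec ?n" "v \<noteq> 0\<^sub>v ?n" "?B *\<^sub>v v = \<zeta> \<cdot>\<^sub>v v"
    using ev block_lower_triangularD(1)[OF B] by (auto simp: eigenvalue_def eigenvector_def)
  obtain i u where i: "i < s" and ne: "\<exists>x\<in>X. u x \<noteq> 0"
    and u: "\<And>x. x \<in> X \<Longrightarrow> (\<Sum>y\<in>X. complex_of_real (g i x y) * u y) = \<zeta> * u x"
    using block_lower_triangular_eigenvector[OF fin B v] by blast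
  let ?N = "(\<Sum>x\<in>X. (Re (u x))\<^sup>2) + (\<Sum>x\<in>X. (Im (u x))\<^sup>2)"
  have N_eq: "?N = (\<Sum>x\<in>X. (cmod (u x))\<^sup>2)" by (simp add: cmod_power2 sum.distrib)
  have "0 < ?N" unfolding N_eq using ne fin by (auto intro!: sum_pos2)
  moreover have "\<zeta> * complex_of_real ?N
      = complex_of_real (quad X (g i) (\<lambda>x. Re (u x)) + quad X (g i) (\<lambda>x. Im (u x)))"
  proof -
    define Z where "Z = (\<Sum>x\<in>X. \<Sum>y\<in>X. complex_of_real (g i x y) * (cnj (u x) * u y))"
    have "\<zeta> * complex_of_real ?N = (\<Sum>x\<in>X. cnj (u x) * (\<zeta> * u x))"
      by (simp add: N_eq sum_distrib_left complex_norm_square mult_ac del: of_real_power)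
    also have "\<dots> = Z" by (simp add: u[symmetric] Z_def sum_distrib_left mult_ac)
    finally have Z: "\<zeta> * complex_of_real ?N = Z" .
    have "Re Z = quad X (g i) (\<lambda>x. Re (u x)) + quad X (g i) (\<lambda>x. Im (u x))"
    proof -
      have "Re Z = (\<Sum>x\<in>X. \<Sum>y\<in>X. g i x y * Re (u x) * Re (u y) + g i x y * Im (u x) * Im (u y))"
        by (simp add: Z_def distrib_left mult.assoc)
      then show ?thesis by (simp only: quad_def sum.distrib)
    qed
    moreover have "Im Z = 0"
    proof -
      have "Im Z = (\<Sum>x\<in>X. \<Sum>y\<in>X. g i x y * (Re (u x) * Im (u y)) - g i x y * (Im (u x) * Re (u y)))"
        by (simp add: Z_def right_diff_distrib)
      also have "\<dots> = (\<Sum>x\<in>X. \<Sum>y\<in>X. g i x y * (Re (u x) * Im (u y)))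
          - (\<Sum>x\<in>X. \<Sum>y\<in>X. g i x y * (Im (u x) * Re (u y)))" by (simp add: sum_subtractf)
      also have "(\<Sum>x\<in>X. \<Sum>y\<in>X. g i x y * (Im (u x) * Re (u y)))
          = (\<Sum>x\<in>X. \<Sum>y\<in>X. g i x y * (Re (u x) * Im (u y)))"
        by (subst sum.swap) (intro sum.cong refl, simp add: sym[OF i] mult_ac)
      finally show ?thesis by simp
    qed
    ultimately show ?thesis unfolding Z by (simp add: complex_eq_iff)
  qed
  ultimately show ?thesis using that[OF i, of "\<lambda>x. Re (u x)" "\<lambda>x. Im (u x)"] by blast
qed

lemma spectral_radius_le:
  fixes A :: "real mat"
  assumes fin: "finite X" and ne: "X \<noteq> {}" and s: "0 < s" and A: "block_lower_triangular s X A g"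
    and sym: "\<And>i x y. i < s \<Longrightarrow> x \<in> X \<Longrightarrow> y \<in> X \<Longrightarrow> g i x y = g i y x"
    and bound: "\<And>i q. i < s \<Longrightarrow> \<bar>quad X (g i) q\<bar> \<le> r * (\<Sum>x\<in>X. (q x)\<^sup>2)"
  shows "real_spectral_radius A \<le> r"
proof -
  let ?B = "map_mat complex_of_real A" and ?n = "card X * s"
  have B: "?B \<in> carrier_mat ?n ?n" using block_lower_triangularD(1)[OF A] by simp
  have n: "0 < ?n" using fin ne s by (simp add: card_gt_0_iff)
  obtain \<zeta> where \<zeta>: "spectral_radius ?B = cmod \<zeta>" "eigenvalue ?B \<zeta>"
    using spectral_radius_mem_max(1)[OF B n] by (auto simp: spectrum_def)
  obtain i q1 q2 where i: "i < s" and N: "0 < (\<Sum>x\<in>X. (q1 x)\<^sup>2) + (\<Sum>x\<in>X. (q2 x)\<^sup>2)"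
    and eq: "\<zeta> * complex_of_real ((\<Sum>x\<in>X. (q1 x)\<^sup>2) + (\<Sum>x\<in>X. (q2 x)\<^sup>2))
      = complex_of_real (quad X (g i) q1 + quad X (g i) q2)"
    using complex_eigenvalue_block_lower_triangular[OF fin A sym \<zeta>(2)] by blast
  let ?N = "(\<Sum>x\<in>X. (q1 x)\<^sup>2) + (\<Sum>x\<in>X. (q2 x)\<^sup>2)" and ?Q = "quad X (g i) q1 + quad X (g i) q2"
  have "cmod \<zeta> * ?N = cmod (\<zeta> * complex_of_real ?N)" using N by (simp only: norm_mult norm_of_real abs_of_pos)
  also have "\<dots> = \<bar>quad X (g i) q1 + quad X (g i) q2\<bar>" unfolding eq by (rule norm_of_real)
  also have "\<dots> \<le> r * ?N" using bound[OF i, of q1] bound[OF i, of q2] by (simp add: distrib_left)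
  finally show ?thesis using N \<zeta>(1) by (simp add: real_spectral_radius_def)
qed

lemma spectral_radius_nonneg:
  fixes A :: "real mat"
  assumes "A \<in> carrier_mat n n" "0 < n"
  shows "0 \<le> real_spectral_radius A"
proof -
  have "map_mat complex_of_real A \<in> carrier_mat n n" using assms by simp
  from spectral_radius_mem_max(1)[OF this assms(2)] show ?thesis
    by (auto simp: real_spectral_radius_def)
qed

text \<open>
  The spectral radius is defined over the complex numbers. This lemma brings it back to a real
  eigenvalue, which the definition of \<open>mu\<close> asks for.
\<close>

lemma spectral_radius_eigenvalue:
  fixes A :: "real mat"
  assumes fin: "finite X" and ne: "X \<noteq> {}" and s: "0 < s" and A: "block_lower_triangular s X A g"
    and sym: "\<And>i x y. i < s \<Longrightarrow> x \<in> X \<Longrightarrow> y \<in> X \<Longrightarrow> g i x y = g i y x"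
  obtains l where "eigenvalue A l" "\<bar>l\<bar> = real_spectral_radius A"
proof -
  let ?B = "map_mat complex_of_real A" and ?n = "card X * s"
  have A': "A \<in> carrier_mat ?n ?n" by (rule block_lower_triangularD(1)[OF A])
  then have B: "?B \<in> carrier_mat ?n ?n" by simp
  have n: "0 < ?n" using fin ne s by (simp add: card_gt_0_iff)
  obtain \<zeta> where \<zeta>: "spectral_radius ?B = cmod \<zeta>" "eigenvalue ?B \<zeta>"
    using spectral_radius_mem_max(1)[OF B n] by (auto simp: spectrum_def)
  obtain i q1 q2 where i: "i < s" and N: "0 < (\<Sum>x\<in>X. (q1 x)\<^sup>2) + (\<Sum>x\<in>X. (q2 x)\<^sup>2)"
    and eq: "\<zeta> * complex_of_real ((\<Sum>x\<in>X. (q1 x)\<^sup>2) + (\<Sum>x\<in>X. (q2 x)\<^sup>2))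
      = complex_of_real (quad X (g i) q1 + quad X (g i) q2)"
    using complex_eigenvalue_block_lower_triangular[OF fin A sym \<zeta>(2)] by blast
  let ?N = "(\<Sum>x\<in>X. (q1 x)\<^sup>2) + (\<Sum>x\<in>X. (q2 x)\<^sup>2)" and ?Q = "quad X (g i) q1 + quad X (g i) q2"
  have "complex_of_real ?N \<noteq> 0" using N by (simp only: of_real_eq_0_iff)
  then have "\<zeta> = complex_of_real (?Q / ?N)"
    using eq unfolding of_real_divide by (metis nonzero_mult_div_cancel_right)
  then obtain l where l: "\<zeta> = complex_of_real l" by blast
  have "poly (char_poly ?B) (complex_of_real l) = 0"
    using \<zeta>(2) l eigenvalue_root_char_poly[OF B] by simp
  then have "complex_of_real (poly (char_poly A) l) = 0"
    unfolding of_real_hom.char_poly_hom[OF A'] by (simp add: of_real_hom.poly_map_poly)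
  then have "eigenvalue A l" using eigenvalue_root_char_poly[OF A'] by simp
  then show ?thesis using that l \<zeta>(1) by (simp add: real_spectral_radius_def)
qed

lemma spectral_radius_cong:
  fixes A B :: "real mat"
  assumes fin: "finite X" and ne: "X \<noteq> {}" and s: "0 < s"
    and A: "block_lower_triangular s X A g" and B: "block_lower_triangular s X B g"
    and sym: "\<And>i x y. i < s \<Longrightarrow> x \<in> X \<Longrightarrow> y \<in> X \<Longrightarrow> g i x y = g i y x"
  shows "real_spectral_radius A = real_spectral_radius B"
  by (intro antisym spectral_radius_le[OF fin ne s A sym] spectral_radius_le[OF fin ne s B sym]
      spectral_radius_bounds_quad[OF fin ne A _ sym] spectral_radius_bounds_quad[OF fin ne B _ sym])

text \<open>
  Evaluate the form at the indicator of \<open>x\<close>.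
\<close>

lemma quad_diagonal_le:
  assumes fin: "finite X" and x: "x \<in> X"
    and bound: "\<And>q. \<bar>quad X g q\<bar> \<le> r * (\<Sum>y\<in>X. (q y)\<^sup>2)"
  shows "g x x \<le> r"
proof -
  let ?q = "\<lambda>y. if y = x then 1 else 0 :: real"
  have "quad X g ?q = (\<Sum>y\<in>X. \<Sum>z\<in>X. if z = x then (if y = x then g x x else 0) else 0)"
    unfolding quad_def by (intro sum.cong refl) auto
  also have "\<dots> = g x x" using fin x by simp
  finally have "quad X g ?q = g x x" .
  moreover have "(\<Sum>y\<in>X. (?q y)\<^sup>2) = (\<Sum>y\<in>X. if y = x then 1 else 0)" by (rule sum.cong) auto
  then have "(\<Sum>y\<in>X. (?q y)\<^sup>2) = 1" using fin x by simp
  ultimately show ?thesis using bound[of ?q] by simp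
qed

section \<open>Trees with lower triangular matrix weights\<close>

locale matrix_weighted_tree = finite_tree T for T :: "'a::linorder pair_pre_digraph" +
  fixes W :: "'a set \<Rightarrow> real mat" and s :: nat
  assumes two_vertices: "2 \<le> card V"
    and s_pos: "1 \<le> s"
    and weight_dim: "\<And>u v. (u, v) \<in> E \<Longrightarrow> W {u, v} \<in> carrier_mat s s"
    and weight_lower_triangular: "\<And>u v i j. (u, v) \<in> E \<Longrightarrow> i < j \<Longrightarrow> j < s \<Longrightarrow> W {u, v} $$ (i, j) = 0"
    and weight_diag_pos: "\<And>u v i. (u, v) \<in> E \<Longrightarrow> i < s \<Longrightarrow> 0 < W {u, v} $$ (i, i)"
begin

definition w :: "nat \<Rightarrow> 'a \<Rightarrow> 'a \<Rightarrow> real" where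
  "w i a b = W {a, b} $$ (i, i)"

lemma weighted: "i < s \<Longrightarrow> weighted_tree T (w i)"
  by unfold_locales (auto simp: w_def insert_commute weight_diag_pos)

abbreviation lap where "lap i \<equiv> weighted_tree.lap T (w i)"
abbreviation shared_resistance where "shared_resistance i \<equiv> weighted_tree.shared_resistance T (w i)"

lemma neighbour_exists:
  assumes "v \<in> V"
  obtains c where "(v, c) \<in> E"
proof -
  have "\<not> V \<subseteq> {v}" using two_vertices card_mono[of "{v}" V] by auto
  then obtain x where "x \<in> V" "x \<noteq> v" by blast
  then show ?thesis using branch_containing[OF assms] that by blast
qed

lemma others_nonempty: "v \<in> V \<Longrightarrow> V - {v} \<noteq> {}"
  using neighbour_exists arc_vertices arc_irrefl by (metis Diff_iff empty_iff singletonD)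

lemma laplacian_blocks: "block_lower_triangular s V (laplacian s T W) lap"
proof -
  have entry: "laplacian_block s T W x y $$ (i, j) =
      (if x = y then (\<Sum>c | (y, c) \<in> E. W {y, c} $$ (i, j))
       else if (x, y) \<in> E then - W {x, y} $$ (i, j) else 0)" if "i < s" "j < s" for x y i j
    using that by (auto simp: laplacian_block_def carrier_matD[OF weight_dim])
  have "block_lower_triangular s V (laplacian s T W) (\<lambda>i x y. laplacian_block s T W x y $$ (i, i))"
    unfolding laplacian_def
    by (rule block_lower_triangular_block_mat) (auto simp: entry weight_lower_triangular)
  then show ?thesis
    by (rule block_lower_triangular_cong)
       (auto simp: entry weighted_tree.lap_def[OF weighted] w_def)
qed

lemma M_mat_blocks:
  assumes "v \<in> V"
  shows "block_lower_triangular s (V - {v}) (M_mat s T W v) (\<lambda>i. shared_resistance i v)"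
  unfolding M_mat_def
proof (rule block_lower_triangular_inverse)
  show "block_lower_triangular s (V - {v})
      (principal_block_submat s V (laplacian s T W) (V - {v})) lap"
    by (rule block_lower_triangular_principal_submat[OF _ _ laplacian_blocks]) auto
qed (use weighted_tree.shared_resistance_inverse[OF weighted assms] in auto)

lemma bottleneck_blocks:
  assumes "(v, c) \<in> E"
  shows "block_lower_triangular s (S v c) (bottleneck s T W v (S v c)) (\<lambda>i. shared_resistance i v)"
  unfolding bottleneck_def
  by (rule block_lower_triangular_principal_submat[OF _ branch_subset M_mat_blocks])
     (use arc_vertices assms in auto)

definition perturbed_bottleneck :: "'a \<Rightarrow> 'a \<Rightarrow> real \<Rightarrow> real mat" where
  "perturbed_bottleneck u v t = bottleneck s T W u (S u v)
     - t \<cdot>\<^sub>m kronecker (all_ones (card (S u v))) (inverse_mat (W {u, v}))"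

lemma edge_radius_eq: "edge_radius s T W u v t = real_spectral_radius (perturbed_bottleneck u v t)"
  by (simp add: edge_radius_def perturbed_bottleneck_def)

lemma perturbed_bottleneck_blocks:
  assumes uv: "(u, v) \<in> E"
  shows "block_lower_triangular s (S u v) (perturbed_bottleneck u v t)
    (\<lambda>i x y. shared_resistance i u x y - t / w i u v)"
proof -
  note inv = lower_triangular_inverse[OF weight_dim[OF uv] weight_lower_triangular[OF uv]
      weight_diag_pos[OF uv, THEN less_imp_neq, THEN not_sym]]
  show ?thesis unfolding perturbed_bottleneck_def
    by (rule block_lower_triangular_cong,
        rule block_lower_triangular_minus_kronecker[OF finite_branch bottleneck_blocks[OF uv]])
       (auto simp: inv w_def)
qed

lemma shared_resistance_sym: "i < s \<Longrightarrow> shared_resistance i v x y = shared_resistance i v y x"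
  using weighted_tree.shared_resistance_sym[OF weighted] by blast

lemma branch_nonempty: "(v, c) \<in> E \<Longrightarrow> S v c \<noteq> {}"
  using arc_root_in_branch by blast

lemma M_mat_bound:
  assumes "v \<in> V" "i < s"
  shows "\<bar>quad (V - {v}) (shared_resistance i v) q\<bar>
    \<le> real_spectral_radius (M_mat s T W v) * (\<Sum>x\<in>V - {v}. (q x)\<^sup>2)"
  by (rule spectral_radius_bounds_quad[OF _ _ M_mat_blocks]) (use assms others_nonempty in \<open>auto intro: shared_resistance_sym\<close>)

lemma bottleneck_bound:
  assumes "(v, c) \<in> E" "i < s"
  shows "\<bar>quad (S v c) (shared_resistance i v) q\<bar>
    \<le> real_spectral_radius (bottleneck s T W v (S v c)) * (\<Sum>x\<in>S v c. (q x)\<^sup>2)"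
  by (rule spectral_radius_bounds_quad[OF _ _ bottleneck_blocks])
     (use assms branch_nonempty in \<open>auto intro: shared_resistance_sym\<close>)

lemma edge_radius_bound:
  assumes "(u, v) \<in> E" "i < s"
  shows "\<bar>quad (S u v) (\<lambda>x y. shared_resistance i u x y - t / w i u v) q\<bar>
    \<le> edge_radius s T W u v t * (\<Sum>x\<in>S u v. (q x)\<^sup>2)"
  unfolding edge_radius_eq
  by (rule spectral_radius_bounds_quad[OF _ _ perturbed_bottleneck_blocks])
     (use assms branch_nonempty in \<open>auto intro: shared_resistance_sym\<close>)

lemma edge_radius_le:
  assumes "(u, v) \<in> E"
    and "\<And>i q. i < s \<Longrightarrow> \<bar>quad (S u v) (\<lambda>x y. shared_resistance i u x y - t / w i u v) q\<bar> \<le> r * (\<Sum>x\<in>S u v. (q x)\<^sup>2)"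
  shows "edge_radius s T W u v t \<le> r"
  unfolding edge_radius_eq
  by (rule spectral_radius_le[OF _ _ _ perturbed_bottleneck_blocks[OF assms(1)]])
     (use assms branch_nonempty s_pos in \<open>auto intro: shared_resistance_sym\<close>)

lemma edge_radius_nonneg:
  assumes uv: "(u, v) \<in> E"
  shows "0 \<le> edge_radius s T W u v t"
  unfolding edge_radius_eq
  by (rule spectral_radius_nonneg[OF block_lower_triangularD(1)[OF perturbed_bottleneck_blocks[OF uv]]])
     (use branch_nonempty[OF uv] s_pos in \<open>simp add: card_gt_0_iff\<close>)

section \<open>Spectral radii bound the smallest nonzero eigenvalue\<close>

text \<open>
  A minimum over the empty set would be an arbitrary number, so a nonzero real eigenvalue has to be
  exhibited. The spectral radius of \<open>L(T)\<close> is positive, being at least a diagonal entry, and plus or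
  minus this radius is an eigenvalue.
\<close>

lemma mu_nonzero_eigenvalue: "eigenvalue (laplacian s T W) (mu s T W)" "mu s T W \<noteq> 0"
proof -
  let ?L = "laplacian s T W"
  let ?Sp = "{l \<in> spectrum ?L. l \<noteq> 0}"
  have V: "V \<noteq> {}" using two_vertices by auto
  then obtain v c where v: "v \<in> V" and vc: "(v, c) \<in> E" using neighbour_exists by blast
  have lap_sym: "lap i x y = lap i y x" if "i < s" for i x y
    using weighted_tree.lap_sym[OF weighted[OF that]] by blast
  have s: "0 < s" using s_pos by simp
  have "lap 0 v v \<le> real_spectral_radius ?L"
    by (rule quad_diagonal_le[OF finite_verts v])
       (rule spectral_radius_bounds_quad[OF finite_verts V laplacian_blocks s lap_sym[OF s]])
  moreover have "0 < lap 0 v v"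
    unfolding weighted_tree.lap_def[OF weighted[OF s]]
    using vc weighted_tree.w_pos[OF weighted[OF s]] weighted_tree.finite_neighbours[OF weighted[OF s]]
    by (auto intro!: sum_pos2[of _ c] less_imp_le)
  moreover obtain l where "eigenvalue ?L l" "\<bar>l\<bar> = real_spectral_radius ?L"
    using spectral_radius_eigenvalue[OF finite_verts V s laplacian_blocks lap_sym] by blast
  ultimately have "l \<in> ?Sp" by (auto simp: spectrum_def)
  moreover have "finite ?Sp"
    using card_finite_spectrum(1)[OF block_lower_triangularD(1)[OF laplacian_blocks]] by simp
  ultimately have "mu s T W \<in> ?Sp" unfolding mu_def by (intro Min_in) auto
  then show "eigenvalue ?L (mu s T W)" "mu s T W \<noteq> 0" by (auto simp: spectrum_def)
qed

text \<open>
  Eigenvectors of a scalar Laplacian for a nonzero eigenvalue have sum zero, because the columns of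
  the Laplacian have sum zero. For them the energy is \<open>mu\<close> times the squared norm.
\<close>

lemma inverse_le_mu:
  assumes r: "0 \<le> r"
    and bound: "\<And>i z. i < s \<Longrightarrow> (\<Sum>x\<in>V. z x) = 0 \<Longrightarrow>
      (\<Sum>x\<in>V. (z x)\<^sup>2) \<le> r * weighted_tree.energy T (w i) z"
  shows "1 / r \<le> mu s T W"
proof -
  let ?n = "card V * s" and ?m = "mu s T W"
  obtain v where "v \<in> carrier_vec ?n" "v \<noteq> 0\<^sub>v ?n" "laplacian s T W *\<^sub>v v = ?m \<cdot>\<^sub>v v"
    using mu_nonzero_eigenvalue(1) block_lower_triangularD(1)[OF laplacian_blocks]
    by (auto simp: eigenvalue_def eigenvector_def)
  from block_lower_triangular_eigenvector[OF finite_verts laplacian_blocks this]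
  obtain i z where i: "i < s" and ne: "\<exists>x\<in>V. z x \<noteq> 0"
    and z: "\<And>x. x \<in> V \<Longrightarrow> (\<Sum>y\<in>V. lap i x y * z y) = ?m * z x" by blast
  interpret wi: weighted_tree T "w i" by (rule weighted[OF i])
  have "?m * (\<Sum>x\<in>V. z x) = 0"
    using wi.sum_lap_eq_0[of z] by (simp add: z sum_distrib_left)
  then have "(\<Sum>x\<in>V. z x) = 0" using mu_nonzero_eigenvalue(2) by simp
  then have "(\<Sum>x\<in>V. (z x)\<^sup>2) \<le> r * wi.energy z" by (rule bound[OF i])
  also have "wi.energy z = (\<Sum>x\<in>V. z x * (\<Sum>y\<in>V. lap i x y * z y))"
    by (simp add: wi.energy_def sum_distrib_left mult.assoc)
  also have "\<dots> = ?m * (\<Sum>x\<in>V. (z x)\<^sup>2)"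
    by (simp add: z, simp add: sum_distrib_left power2_eq_square mult_ac)
  finally have "1 * (\<Sum>x\<in>V. (z x)\<^sup>2) \<le> (r * ?m) * (\<Sum>x\<in>V. (z x)\<^sup>2)" by (simp add: mult_ac)
  moreover have "0 < (\<Sum>x\<in>V. (z x)\<^sup>2)" using ne by (auto intro!: sum_pos2)
  ultimately have *: "1 \<le> r * ?m" by (simp only: mult_le_cancel_right_pos)
  then have "0 < r" using r by (cases "r = 0") auto
  then show ?thesis using * by (simp add: pos_divide_le_eq mult.commute)
qed

lemma inverse_M_mat_radius_le_mu:
  assumes v: "v \<in> V"
  shows "1 / real_spectral_radius (M_mat s T W v) \<le> mu s T W"
proof (rule inverse_le_mu)
  show nonneg: "0 \<le> real_spectral_radius (M_mat s T W v)"
    by (rule spectral_radius_nonneg[OF block_lower_triangularD(1)[OF M_mat_blocks[OF v]]])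
       (use others_nonempty[OF v] s_pos in \<open>auto simp: card_gt_0_iff\<close>)
  fix i and z :: "'a \<Rightarrow> real" assume i: "i < s" and z: "(\<Sum>x\<in>V. z x) = 0"
  show "(\<Sum>x\<in>V. (z x)\<^sup>2) \<le> real_spectral_radius (M_mat s T W v) * weighted_tree.energy T (w i) z"
    by (rule weighted_tree.vertex_bound[OF weighted[OF i] v nonneg _ z])
       (rule order_trans[OF abs_ge_self M_mat_bound[OF v i, unfolded quad_def]])
qed

lemma inverse_edge_radius_le_mu:
  assumes uv: "(u, v) \<in> E" and \<nu>: "0 < \<nu>" "\<nu> < 1"
    and eq: "edge_radius s T W u v \<nu> = edge_radius s T W v u (1 - \<nu>)"
  shows "1 / edge_radius s T W u v \<nu> \<le> mu s T W"
proof (rule inverse_le_mu)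
  show nonneg: "0 \<le> edge_radius s T W u v \<nu>" by (rule edge_radius_nonneg[OF uv])
  fix i and z :: "'a \<Rightarrow> real" assume i: "i < s" and z: "(\<Sum>x\<in>V. z x) = 0"
  show "(\<Sum>x\<in>V. (z x)\<^sup>2) \<le> edge_radius s T W u v \<nu> * weighted_tree.energy T (w i) z"
    by (rule weighted_tree.edge_bound[OF weighted[OF i] uv nonneg \<nu> _ _ z])
       (rule order_trans[OF abs_ge_self edge_radius_bound[OF uv i, unfolded quad_def]]
          order_trans[OF abs_ge_self
            edge_radius_bound[OF arc_sym[OF uv] i, unfolded quad_def, of "1 - \<nu>", folded eq]])+
qed

section \<open>Existence of a characteristic-like vertex or edge\<close>

abbreviation rho where "rho v \<equiv> real_spectral_radius (M_mat s T W v)"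
abbreviation rho_branch where "rho_branch v c \<equiv> real_spectral_radius (bottleneck s T W v (S v c))"

lemma rho_branch_le:
  assumes vc: "(v, c) \<in> E"
  shows "rho_branch v c \<le> rho v"
proof (rule spectral_radius_le[OF finite_branch branch_nonempty[OF vc] _ bottleneck_blocks[OF vc]])
  have v: "v \<in> V" using arc_vertices vc by blast
  fix i and q :: "'a \<Rightarrow> real" assume i: "i < s"
  let ?q = "\<lambda>x. if x \<in> S v c then q x else 0"
  have sub: "S v c \<subseteq> V - {v}" by (rule branch_subset)
  have "quad (S v c) (shared_resistance i v) q = quad (V - {v}) (shared_resistance i v) ?q"
    unfolding quad_def
    by (rule sum.mono_neutral_cong_left; (rule sum.mono_neutral_cong_left)?) (use sub in auto)
  moreover have "(\<Sum>x\<in>V - {v}. (?q x)\<^sup>2) = (\<Sum>x\<in>S v c. (q x)\<^sup>2)"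
    by (rule sum.mono_neutral_cong_right) (use sub in auto)
  ultimately show "\<bar>quad (S v c) (shared_resistance i v) q\<bar> \<le> rho v * (\<Sum>x\<in>S v c. (q x)\<^sup>2)"
    using M_mat_bound[OF v i, of ?q] by simp
qed (use s_pos in \<open>auto intro: shared_resistance_sym\<close>)

text \<open>
  The bottleneck matrix at \<open>v\<close> is block diagonal over the branches, so its quadratic form is bounded by the
  largest of the spectral radii of the blocks.
\<close>

lemma rho_attained:
  assumes v: "v \<in> V"
  obtains c where "(v, c) \<in> E" "rho_branch v c = rho v"
proof -
  let ?N = "{c. (v, c) \<in> E}"
  have fin: "finite ?N" by (rule finite_subset[OF _ finite_verts]) (use arc_vertices in blast)
  have ne: "?N \<noteq> {}" using neighbour_exists[OF v] by blast
  define r where "r = Max (rho_branch v ` ?N)"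
  have r: "rho_branch v c \<le> r" if "(v, c) \<in> E" for c
    unfolding r_def using fin that by (intro Max_ge) auto
  have "rho v \<le> r"
  proof (rule spectral_radius_le[OF _ others_nonempty[OF v] _ M_mat_blocks[OF v]])
    fix i and q :: "'a \<Rightarrow> real" assume i: "i < s"
    interpret wi: weighted_tree T "w i" by (rule weighted[OF i])
    have "\<bar>quad (V - {v}) (shared_resistance i v) q\<bar> = \<bar>\<Sum>c\<in>?N. quad (S v c) (shared_resistance i v) q\<bar>"
      unfolding quad_def by (simp only: wi.shared_resistance_block_diagonal[OF v])
    also have "\<dots> \<le> (\<Sum>c\<in>?N. r * (\<Sum>x\<in>S v c. (q x)\<^sup>2))"
      by (rule order_trans[OF sum_abs], rule sum_mono, rule order_trans[OF bottleneck_bound])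
         (auto intro!: mult_right_mono r sum_nonneg i)
    also have "\<dots> = r * (\<Sum>x\<in>V - {v}. (q x)\<^sup>2)"
      by (simp only: wi.sum_over_branches[OF v] sum_distrib_left)
    finally show "\<bar>quad (V - {v}) (shared_resistance i v) q\<bar> \<le> r * (\<Sum>x\<in>V - {v}. (q x)\<^sup>2)" .
  qed (use s_pos in \<open>auto intro: shared_resistance_sym\<close>)
  moreover have "r \<in> rho_branch v ` ?N" unfolding r_def using fin ne by (intro Max_in) auto
  then obtain c where "(v, c) \<in> E" "r = rho_branch v c" by auto
  ultimately show ?thesis using that rho_branch_le by (metis order_antisym)
qed

lemma rho_pos:
  assumes v: "v \<in> V"
  shows "0 < rho v"
proof -
  obtain x where x: "x \<in> V - {v}" using others_nonempty[OF v] by blast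
  have s: "0 < s" using s_pos by simp
  have "shared_resistance 0 v x x \<le> rho v"
    by (rule quad_diagonal_le[OF _ x M_mat_bound[OF v s]]) simp
  then show ?thesis using weighted_tree.shared_resistance_pos[OF weighted[OF s] v x] by linarith
qed

lemma perron_branches_eq:
  assumes "v \<in> V"
  shows "perron_branches s T W v = S v ` {c. (v, c) \<in> E \<and> rho_branch v c = rho v}"
  unfolding perron_branches_def branches_eq[OF assms] by auto

lemma rho_branch_less:
  assumes uv: "(u, v) \<in> E" and perron: "perron_branches s T W u = {S u v}"
    and c: "(u, c) \<in> E" "c \<noteq> v"
  shows "rho_branch u c < rho u"
proof -
  have u: "u \<in> V" using arc_vertices uv by blast
  have "S u c \<noteq> S u v" using branches_disjoint[OF c(1) uv] arc_root_in_branch[OF uv] c by blast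
  then have "rho_branch u c \<noteq> rho u" using perron c(1) unfolding perron_branches_eq[OF u] by blast
  then show ?thesis using rho_branch_le[OF c(1)] by simp
qed

text \<open>
  By \<open>shared_resistance_without_edge\<close>, at \<open>\<nu> = 0\<close> the side of \<open>u\<close> only sees the branches at \<open>u\<close> that do not contain
  \<open>v\<close>. None of them is a Perron branch. The maximum includes 0 because \<open>u\<close> may be a leaf.
\<close>

lemma edge_radius_1_less:
  assumes uv: "(u, v) \<in> E" and perron: "perron_branches s T W u = {S u v}"
  shows "edge_radius s T W v u 1 < rho u"
proof -
  let ?N = "{c. (u, c) \<in> E \<and> c \<noteq> v}"
  have u: "u \<in> V" using arc_vertices uv by blast
  have fin: "finite ?N" by (rule finite_subset[OF _ finite_verts]) (use arc_vertices in blast)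
  define r where "r = Max (insert 0 (rho_branch u ` ?N))"
  have r: "rho_branch u c \<le> r" if "(u, c) \<in> E" "c \<noteq> v" for c
    unfolding r_def using fin that by (intro Max_ge) auto
  have r0: "0 \<le> r" unfolding r_def using fin by (intro Max_ge) auto
  have "r < rho u"
    unfolding r_def using fin rho_pos[OF u] rho_branch_less[OF uv perron] by (subst Max_less_iff) auto
  moreover have "edge_radius s T W v u 1 \<le> r"
  proof (rule edge_radius_le[OF arc_sym[OF uv]])
    fix i and q :: "'a \<Rightarrow> real" assume i: "i < s"
    interpret wi: weighted_tree T "w i" by (rule weighted[OF i])
    have "\<bar>quad (S v u) (\<lambda>x y. shared_resistance i v x y - 1 / w i v u) q\<bar>
        = \<bar>\<Sum>c\<in>?N. quad (S u c) (shared_resistance i u) q\<bar>"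
      unfolding quad_def by (simp only: wi.shared_resistance_without_edge[OF uv])
    also have "\<dots> \<le> (\<Sum>c\<in>?N. r * (\<Sum>x\<in>S u c. (q x)\<^sup>2))"
      by (rule order_trans[OF sum_abs], rule sum_mono, rule order_trans[OF bottleneck_bound])
         (auto intro!: mult_right_mono r sum_nonneg i)
    also have "\<dots> = r * (\<Sum>x\<in>(\<Union>c\<in>?N. S u c). (q x)\<^sup>2)"
    proof -
      have "\<forall>c\<in>?N. \<forall>d\<in>?N. c \<noteq> d \<longrightarrow> S u c \<inter> S u d = {}" using branches_disjoint by blast
      then have "(\<Sum>x\<in>(\<Union>c\<in>?N. S u c). (q x)\<^sup>2) = (\<Sum>c\<in>?N. \<Sum>x\<in>S u c. (q x)\<^sup>2)"
        by (intro sum.UNION_disjoint[OF fin]) auto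
      then show ?thesis by (simp only: sum_distrib_left)
    qed
    also have "\<dots> \<le> r * (\<Sum>x\<in>S v u. (q x)\<^sup>2)"
    proof (intro mult_left_mono[OF _ r0] sum_mono2)
      show "(\<Union>c\<in>?N. S u c) \<subseteq> S v u"
        using branches_disjoint[OF uv] branch_in_verts unfolding branch_complement[OF uv] by blast
    qed auto
    finally show "\<bar>quad (S v u) (\<lambda>x y. shared_resistance i v x y - 1 / w i v u) q\<bar> \<le> r * (\<Sum>x\<in>S v u. (q x)\<^sup>2)" .
  qed
  ultimately show ?thesis by simp
qed

lemma edge_radius_0:
  assumes uv: "(u, v) \<in> E"
  shows "edge_radius s T W u v 0 = rho_branch u v"
  unfolding edge_radius_eq
proof (rule spectral_radius_cong[OF finite_branch branch_nonempty[OF uv]])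
  show "block_lower_triangular s (S u v) (perturbed_bottleneck u v 0) (\<lambda>i. shared_resistance i u)"
    by (rule block_lower_triangular_cong[OF perturbed_bottleneck_blocks[OF uv]]) simp
qed (use s_pos bottleneck_blocks[OF uv] in \<open>auto intro: shared_resistance_sym\<close>)

text \<open>
  A uniform bound on the change of the quadratic forms is a bound on the change of the radius, by the
  two descriptions of the spectral radius.
\<close>

lemma edge_radius_lipschitz:
  assumes uv: "(u, v) \<in> E"
  obtains K where "K-lipschitz_on UNIV (edge_radius s T W u v)"
proof -
  define k where "k = (\<Sum>i<s. 1 / w i u v)"
  have w_pos: "0 < w i u v" if "i < s" for i using weight_diag_pos[OF uv that] by (simp add: w_def)
  have k: "1 / w i u v \<le> k" if "i < s" for i
    unfolding k_def using that w_pos by (intro member_le_sum) (auto simp: less_imp_le)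
  have k0: "0 \<le> k" unfolding k_def by (intro sum_nonneg) (use w_pos in \<open>auto simp: less_imp_le\<close>)
  let ?K = "k * card (S u v)"
  have step: "edge_radius s T W u v t \<le> edge_radius s T W u v t' + ?K * \<bar>t - t'\<bar>" for t t'
  proof (rule edge_radius_le[OF uv])
    fix i and q :: "'a \<Rightarrow> real" assume i: "i < s"
    let ?Q = "\<lambda>t. quad (S u v) (\<lambda>x y. shared_resistance i u x y - t / w i u v) q"
    let ?N = "\<Sum>x\<in>S u v. (q x)\<^sup>2"
    have "?Q t - ?Q t' = (\<Sum>x\<in>S u v. \<Sum>y\<in>S u v. ((t' - t) * (1 / w i u v)) * (q x * q y))"
      unfolding quad_def sum_subtractf[symmetric]
      by (intro sum.cong refl) (simp add: algebra_simps diff_divide_distrib)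
    also have "\<dots> = (t' - t) * (1 / w i u v) * (\<Sum>x\<in>S u v. q x)\<^sup>2"
      by (simp only: power2_eq_square sum_product sum_distrib_left[symmetric])
    finally have "\<bar>?Q t\<bar> \<le> \<bar>?Q t'\<bar> + \<bar>(t' - t) * (1 / w i u v) * (\<Sum>x\<in>S u v. q x)\<^sup>2\<bar>" by linarith
    also have "\<bar>(t' - t) * (1 / w i u v) * (\<Sum>x\<in>S u v. q x)\<^sup>2\<bar>
        = \<bar>t - t'\<bar> * (1 / w i u v) * (\<Sum>x\<in>S u v. q x)\<^sup>2"
      using w_pos[OF i] by (simp add: abs_mult abs_minus_commute)
    also have "\<dots> \<le> \<bar>t - t'\<bar> * k * (?N * card (S u v))"
      using k[OF i] k0 w_pos[OF i] sum_squared_le_sum_of_squares[of q "S u v"]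
      by (intro mult_mono) auto
    also have "\<bar>?Q t'\<bar> \<le> edge_radius s T W u v t' * ?N" by (rule edge_radius_bound[OF uv i])
    finally show "\<bar>?Q t\<bar> \<le> (edge_radius s T W u v t' + ?K * \<bar>t - t'\<bar>) * ?N"
      by (simp add: distrib_right distrib_left mult_ac)
  qed
  show ?thesis
  proof (rule that[of ?K], rule lipschitz_onI)
    fix t t' :: real
    show "dist (edge_radius s T W u v t) (edge_radius s T W u v t') \<le> ?K * dist t t'"
      using step[of t t'] step[of t' t] unfolding dist_real_def abs_minus_commute[of t' t] by linarith
  qed (use k0 in simp)
qed

lemma balanced_point_exists:
  assumes edge: "characteristic_like_edge s T W u v"
  obtains \<nu> where "0 < \<nu>" "\<nu> < 1" "edge_radius s T W u v \<nu> = edge_radius s T W v u (1 - \<nu>)"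
proof -
  have uv: "(u, v) \<in> E" and Pu: "perron_branches s T W u = {S u v}"
    and Pv: "perron_branches s T W v = {S v u}"
    using edge by (auto simp: characteristic_like_edge_def)
  have vu: "(v, u) \<in> E" using arc_sym uv by blast
  have full: "rho_branch a b = rho a" if "(a, b) \<in> E" "perron_branches s T W a = {S a b}" for a b
    using that unfolding perron_branches_def by auto
  let ?f = "\<lambda>t. edge_radius s T W u v t - edge_radius s T W v u (1 - t)"
  have cont1: "continuous_on UNIV (edge_radius s T W a b)" if "(a, b) \<in> E" for a b
    using edge_radius_lipschitz[OF that] lipschitz_on_continuous_on by blast
  have "continuous_on {0..1} (\<lambda>t. edge_radius s T W v u (1 - t))"
    by (rule continuous_on_compose2[OF cont1[OF vu]]) (auto intro: continuous_intros)
  then have cont: "continuous_on {0..1} ?f"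
    using continuous_on_subset[OF cont1[OF uv] subset_UNIV] by (rule continuous_on_diff[rotated])
  have f0: "0 < ?f 0"
    using edge_radius_1_less[OF uv Pu] edge_radius_0[OF uv] full[OF uv Pu] by simp
  have f1: "?f 1 < 0"
    using edge_radius_1_less[OF vu Pv] edge_radius_0[OF vu] full[OF vu Pv] by simp
  obtain \<nu> where "0 \<le> \<nu>" "\<nu> \<le> 1" "?f \<nu> = 0"
    using IVT2'[of ?f 1 0 0] f0 f1 cont by auto
  moreover have "\<nu> \<noteq> 0" "\<nu> \<noteq> 1" using f0 f1 \<open>?f \<nu> = 0\<close> by auto
  ultimately show ?thesis using that[of \<nu>] by simp
qed

lemma characteristic_like_exists:
  "(\<exists>v. characteristic_like_vertex s T W v) \<or> (\<exists>u v. characteristic_like_edge s T W u v)"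
proof (rule disjCI)
  assume no_edge: "\<not> (\<exists>u v. characteristic_like_edge s T W u v)"
  show "\<exists>v. characteristic_like_vertex s T W v"
  proof (rule ccontr)
    assume no_vertex: "\<not> ?thesis"
    have "\<exists>c. (v, c) \<in> E \<and> perron_branches s T W v = {S v c}" if v: "v \<in> V" for v
    proof -
      let ?P = "perron_branches s T W v"
      obtain c where c: "(v, c) \<in> E" "rho_branch v c = rho v" by (rule rho_attained[OF v])
      then have cP: "S v c \<in> ?P" unfolding perron_branches_eq[OF v] by blast
      have "finite {c. (v, c) \<in> E \<and> rho_branch v c = rho v}"
        by (rule finite_subset[OF _ finite_verts]) (use arc_vertices in blast)
      then have "finite ?P" unfolding perron_branches_eq[OF v] by blast
      moreover have "card ?P \<le> 1" using no_vertex v unfolding characteristic_like_vertex_def by force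
      ultimately have "?P = {S v c}" 
        using cP card_le_Suc0_iff_eq[of ?P] by auto
      then show ?thesis using c(1) by blast
    qed
    then obtain f where f: "\<And>v. v \<in> V \<Longrightarrow> (v, f v) \<in> E \<and> perron_branches s T W v = {S v (f v)}"
      by metis
    have "V \<noteq> {}" using two_vertices by auto
    then obtain v where v: "v \<in> V" "f (f v) = v"
      using neighbour_choice_reversed_somewhere[of f] f by blast
    have "f v \<in> V" using f[OF v(1)] arc_vertices by blast
    then have "characteristic_like_edge s T W v (f v)"
      using f[OF v(1)] f[of "f v"] v(2) unfolding characteristic_like_edge_def by simp
    then show False using no_edge by blast
  qed
qed

lemma kappa_le_mu: "kappa s T W \<le> mu s T W"
proof -
  let ?P = "\<lambda>k. (\<exists>v. characteristic_like_vertex s T W v \<and> k = 1 / rho v) \<or>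
     (\<exists>u v \<nu>. characteristic_like_edge s T W u v \<and> 0 < \<nu> \<and> \<nu> < 1 \<and>
        edge_radius s T W u v \<nu> = edge_radius s T W v u (1 - \<nu>) \<and>
        k = 1 / edge_radius s T W u v \<nu>)"
  have "\<exists>k. ?P k" using characteristic_like_exists balanced_point_exists by metis
  then have "?P (kappa s T W)" unfolding kappa_def by (rule someI_ex)
  then show ?thesis
  proof (elim disjE exE conjE)
    fix v assume "characteristic_like_vertex s T W v" "kappa s T W = 1 / rho v"
    then show ?thesis using inverse_M_mat_radius_le_mu by (simp add: characteristic_like_vertex_def)
  next
    fix u v \<nu> assume "characteristic_like_edge s T W u v" "0 < \<nu>" "\<nu> < 1"
      "edge_radius s T W u v \<nu> = edge_radius s T W v u (1 - \<nu>)" "kappa s T W = 1 / edge_radius s T W u v \<nu>"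
    then show ?thesis using inverse_edge_radius_le_mu by (simp add: characteristic_like_edge_def)
  qed
qed

end

theorem theorem4p7:
  fixes T :: "'a::linorder pair_pre_digraph"
    and W :: "'a set \<Rightarrow> real mat"
    and s :: nat
  assumes tree: "is_tree T"
    and two_vertices: "2 \<le> card (pverts T)"
    and s_pos: "1 \<le> s"
    and weight_dim: "\<And>u v. (u, v) \<in> parcs T \<Longrightarrow> W {u, v} \<in> carrier_mat s s"
    and weight_lower_triangular: "\<And>u v i j. (u, v) \<in> parcs T \<Longrightarrow> i < j \<Longrightarrow> j < s \<Longrightarrow>
          W {u, v} $$ (i, j) = 0"
    and weight_diag_pos: "\<And>u v i. (u, v) \<in> parcs T \<Longrightarrow> i < s \<Longrightarrow> 0 < W {u, v} $$ (i, i)"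
  shows "kappa s T W \<le> mu s T W"
proof -
  interpret matrix_weighted_tree T W s
    by unfold_locales (use assms in auto)
  show ?thesis by (rule kappa_le_mu)
qed

end
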